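(* For every integer $n \geq 2$, the Higman--Thompson group $V_n$ and its derived subgroup $V_n'$ are both $\frac{3}{2}$-generated.
   Context: A group $G$ is $\frac{3}{2}$-generated if $G$ can be generated by two elements and, moreover, for every nontrivial $g \in G$ there exists $h \in G$ such that $\langle g, h\rangle = G$. Definition of $V_n$. Fix $n \geq 2$ and write $[n] = \{0,1,\dots,n-1\}$. Let $X_n = [n]^*$ be the set of all finite words over $[n]$ and $\mathfrak{C}_n = [n]^{\mathbb{N}}$ the set of all infinite sequences over $[n]$. For $u \in X_n$ write $u\mathfrak{C}_n = \{uw \mid w \in \mathfrak{C}_n\}$. A finite set $A \subseteq X_n$ is a basis of $\mathfrak{C}_n$ if $\{u\mathfrak{C}_n \mid u \in A\}$ is a partition of $\mathfrak{C}_n$. The Higman--Thompson group $V_n$ is the group of bijections $g \in \mathrm{Sym}(\mathfrak{C}_n)$ (acting on the right) for which there exist bases $A$ and $B$ of $\mathfrak{C}_n$ and a bijection $\sigma\colon A \to B$ such that $(uw)g = (u\sigma)w$ for all $u \in A$ and all $w \in \mathfrak{C}_n$. $V_n'$ denotes the derived (commutator) subgroup of $V_n$. *)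

theory Defs
  imports "HOL-Algebra.Bij" "HOL-Algebra.Generated_Groups"
    "HOL-Library.Stream" "HOL-Library.Disjoint_Sets"
begin

definition cantor_space :: "nat \<Rightarrow> nat stream set" where
  "cantor_space n = streams {..<n}"

definition cone :: "nat \<Rightarrow> nat list \<Rightarrow> nat stream set" where
  "cone n u = {u @- w | w. w \<in> cantor_space n}"

definition cantor_basis :: "nat \<Rightarrow> nat list set \<Rightarrow> bool" where
  "cantor_basis n A \<longleftrightarrow>
     finite A \<and> A \<subseteq> lists {..<n} \<and> partition_on (cantor_space n) (cone n ` A)"

text \<open>
  The elements of \<open>Bij S\<close> are the permutations of \<open>S\<close>, normalised to be \<open>undefined\<close> outside \<open>S\<close>.
  The group acts on the right, so the product of \<open>g\<close> and \<open>h\<close> applies \<open>g\<close> first; this is the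
  opposite of the multiplication of \<open>BijGroup\<close>.
\<close>

definition higman_thompson :: "nat \<Rightarrow> (nat stream \<Rightarrow> nat stream) monoid" where
  "higman_thompson n =
     \<lparr>carrier = {g \<in> Bij (cantor_space n).
        \<exists>A B \<sigma>. cantor_basis n A \<and> cantor_basis n B \<and> bij_betw \<sigma> A B \<and>
          (\<forall>u\<in>A. \<forall>w\<in>cantor_space n. g (u @- w) = \<sigma> u @- w)},
      mult = (\<lambda>g h. compose (cantor_space n) h g),
      one = (\<lambda>w\<in>cantor_space n. w)\<rparr>"

definition derived_subgroup :: "('a, 'b) monoid_scheme \<Rightarrow> ('a, 'b) monoid_scheme" where
  "derived_subgroup G = G\<lparr>carrier := derived G (carrier G)\<rparr>"

definition three_halves_generated :: "('a, 'b) monoid_scheme \<Rightarrow> bool" where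
  "three_halves_generated G \<longleftrightarrow>
     group G \<and>
     (\<exists>a\<in>carrier G. \<exists>b\<in>carrier G. generate G {a, b} = carrier G) \<and>
     (\<forall>g\<in>carrier G. g \<noteq> \<one>\<^bsub>G\<^esub> \<longrightarrow> (\<exists>h\<in>carrier G. generate G {g, h} = carrier G))"

end

(*
  The finite-order elements used are products of cycles: cyc [a1, ..., ap] permutes cyclically the
  pairwise disjoint cones of a1, ..., ap.  A nontrivial g carries some cone u to a disjoint cone v
  by a prefix replacement.  Take h to be a product of commuting cycles of pairwise coprime lengths,
  so that every subgroup H containing h contains each of the cycles:
    h2, a 3-cycle of words below u, so that its conjugate by g is a 3-cycle (x y z) below v;
    h1, a long cycle fixing x and y and moving z through almost all of a complete antichain X
      containing u L and v L, where L consists of the words of some length;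
    h3, a cycle below u whose conjugate by g moves a word below v through all children of another.
  Conjugating (x y z) by h1 gives all (x y z') with z' in the cycle, hence all 3-cycles of X that
  avoid a part of u L, and conjugating by g all 3-cycles of X; h3 does the same for X with one leaf
  replaced by its children.  This propagates to all expansions of X, so H contains every 3-cycle of
  long words.  Such an H satisfies V_n = H \<union> H t for every transposition t of two long words of
  equal length, so H contains the derived subgroup.  For V_n' all cycles have odd order, which
  places h in V_n'; for V_n a transposition h4 of two long words is multiplied to h.
*)
theory Submission
  imports Defs "HOL-Library.Sublist"
begin

section \<open>Words, streams and groups\<close>

text \<open>Two constraints shape the construction. Of \<open>g\<close> only its action on one cone
  is known, so every cycle that is to be conjugated by \<open>g\<close> must lie below
  \<open>u\<close>. And a single \<open>h\<close> has to carry all the cycles, so these must be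
  disjoint in order to commute. The long cycle h1 therefore cannot run through all of X: it has to
  leave room below \<open>u\<close>. It covers the words of X outside \<open>u\<close> except x and
  y, and those below \<open>u\<close> are recovered from those below \<open>v\<close> by the inverse
  of \<open>g\<close>. Two families of 3-cycles can be glued as soon as they share two words, which
  is why h1 also visits at least two words below \<open>u\<close>. One expanded leaf is enough,
  because a 3-cycle of X carries it to any other leaf. Only long words are reached, since short ones
  need not lie below a leaf of X. Hence an arbitrary element is first multiplied into a permutation
  of all words of one large length; there the 3-cycles give the even permutations, and only a sign
  remains. This sign may obstruct the generation of V_n by 3-cycles, whence the extra
  transposition.\<close>

lemma shift_eq_shiftD:
  assumes "u @- x = v @- y" and "length u \<le> length v"
  shows "\<exists>t. v = u @ t \<and> x = t @- y"
  using assms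
proof (induction u arbitrary: v)
  case (Cons a u)
  then obtain b v' where "v = b # v'" by (cases v) auto
  with Cons show ?case by auto
qed auto

lemma parallel_shift_neq:
  assumes "u \<parallel> v"
  shows "u @- x \<noteq> v @- y"
  using assms shift_eq_shiftD[of u x v y] shift_eq_shiftD[of v y u x]
  by (metis nat_le_linear parallelD1 parallelD2 prefixI)

lemma sorted_wrt_parallelI:
  assumes "distinct xs" and "pairwise (\<parallel>) (set xs)"
  shows "sorted_wrt (\<parallel>) xs"
  using assms by (auto simp: sorted_wrt_iff_nth_less pairwise_def nth_eq_iff_index_eq)

lemma sorted_wrt_parallel_nth:
  assumes "sorted_wrt (\<parallel>) xs" "i < length xs" "j < length xs" "i \<noteq> j"
  shows "xs ! i \<parallel> xs ! j"
  using assms by (metis parallel_commute nat_neq_iff sorted_wrt_iff_nth_less)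

text \<open>By the hypothesis on \<open>t\<close> there are at most two cosets, so membership in
  \<open>H\<close> behaves like the kernel of a sign. If \<open>x\<close> and \<open>y\<close> are
  both outside, then \<open>x \<otimes> t\<close> and \<open>inv y \<otimes> t\<close> are inside,
  and \<open>t\<close> cancels in the first times the inverse of the second.\<close>

lemma (in group) index_two_mult:
  assumes H: "subgroup H G" and t: "t \<in> carrier G" "\<And>f. f \<in> carrier G \<Longrightarrow> f \<in> H \<or> f \<otimes> t \<in> H"
    and c: "x \<in> carrier G" "y \<in> carrier G"
  shows "x \<otimes> y \<in> H \<longleftrightarrow> (x \<in> H \<longleftrightarrow> y \<in> H)"
proof -
  have inv: "inv f \<in> H \<longleftrightarrow> f \<in> H" if "f \<in> carrier G" for f
    using that subgroup.m_inv_closed[OF H, of f] subgroup.m_inv_closed[OF H, of "inv f"] by auto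
  have 1: "y \<in> H" if "x \<otimes> y \<in> H" "x \<in> H"
  proof -
    have "inv x \<otimes> (x \<otimes> y) \<in> H" using that H by (simp add: subgroup.m_closed subgroup.m_inv_closed)
    then show ?thesis using c by (simp flip: m_assoc)
  qed
  have 2: "x \<in> H" if "x \<otimes> y \<in> H" "y \<in> H"
  proof -
    have "(x \<otimes> y) \<otimes> inv y \<in> H" using that H by (simp add: subgroup.m_closed subgroup.m_inv_closed)
    then show ?thesis using c by (simp add: m_assoc)
  qed
  have 3: "x \<otimes> y \<in> H" if "x \<notin> H" "y \<notin> H"
  proof -
    have "x \<otimes> t \<in> H" "inv y \<otimes> t \<in> H" using t(2) c that inv by auto
    then have "(x \<otimes> t) \<otimes> inv (inv y \<otimes> t) \<in> H" using H by (simp add: subgroup.m_closed subgroup.m_inv_closed)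
    moreover have "t \<otimes> (inv t \<otimes> y) = y" using c t(1) by (simp flip: m_assoc)
    ultimately show ?thesis using c t(1) by (simp add: inv_mult_group m_assoc)
  qed
  show ?thesis using 1 2 3 subgroup.m_closed[OF H] by blast
qed

text \<open>Each of \<open>x\<close> and \<open>y\<close> enters a commutator twice, so its sign is
  trivial.\<close>

lemma (in group) index_two_derived:
  assumes H: "subgroup H G" and t: "t \<in> carrier G" "\<And>f. f \<in> carrier G \<Longrightarrow> f \<in> H \<or> f \<otimes> t \<in> H"
  shows "derived G (carrier G) \<subseteq> H"
  unfolding derived_def
proof (rule generate_subgroup_incl[OF _ H])
  note mult = index_two_mult[OF H t]
  have inv: "inv f \<in> H \<longleftrightarrow> f \<in> H" if "f \<in> carrier G" for f
    using that subgroup.m_inv_closed[OF H, of f] subgroup.m_inv_closed[OF H, of "inv f"] by auto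
  have "x \<otimes> y \<otimes> inv x \<otimes> inv y \<in> H" if "x \<in> carrier G" "y \<in> carrier G" for x y
    using that by (simp add: mult inv) blast
  then show "derived_set G (carrier G) \<subseteq> H" by auto
qed

text \<open>By Bezout some multiple of \<open>q\<close> is 1 modulo \<open>p\<close>; that power of
  \<open>a \<otimes> b\<close> kills \<open>b\<close> and leaves \<open>a\<close>. This is what
  allows one generator to encode several.\<close>

lemma (in group) commuting_coprime_factors:
  fixes p q :: nat
  assumes H: "subgroup H G" and c: "a \<in> carrier G" "b \<in> carrier G" "a \<otimes> b = b \<otimes> a"
    and ord: "a [^] p = \<one>" "b [^] q = \<one>" "coprime p q" "q \<noteq> 0"
    and mem: "a \<otimes> b \<in> H"
  shows "a \<in> H" "b \<in> H"
proof -
  have pow: "x [^] k \<in> H" if "x \<in> H" for x and k :: nat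
    using that H by (induction k) (simp_all add: subgroup.m_closed subgroup.one_closed)
  obtain x y where xy: "q * x = p * y + 1" using bezout_nat[OF ord(4), of p] ord(3)
    by (auto simp: coprime_iff_gcd_eq_1 gcd.commute)
  have "(a \<otimes> b) [^] (q * x) = a [^] (q * x) \<otimes> b [^] (q * x)"
    using c by (intro pow_mult_distrib)
  also have "b [^] (q * x) = \<one>" using c ord(2) by (simp flip: nat_pow_pow)
  also have "a [^] (q * x) = a" unfolding xy using c ord(1)
    by (simp flip: nat_pow_mult nat_pow_pow)
  finally have "(a \<otimes> b) [^] (q * x) = a" using c by simp
  then show a: "a \<in> H" using pow[OF mem, of "q * x"] by simp
  have "inv a \<otimes> (a \<otimes> b) \<in> H" using H a mem by (simp add: subgroup.m_closed subgroup.m_inv_closed)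
  then show "b \<in> H" using c(1,2) by (simp flip: m_assoc)
qed

section \<open>Prefix replacements and cycles of cones\<close>

locale higman_thompson_group =
  fixes n :: nat and G :: "(nat stream \<Rightarrow> nat stream) monoid" (structure)
  assumes two_le: "2 \<le> n" and G_def: "G = higman_thompson n"
begin

abbreviation "C \<equiv> cantor_space n"

section \<open>Words, levels and prefix replacement on cones\<close>

definition words :: "nat list set" where
  "words = lists {..<n}"

definition level :: "nat \<Rightarrow> nat list set" where
  "level m = {u \<in> words. length u = m}"

text \<open>A relation and not a function of \<open>f\<close> and \<open>u\<close>, since an element
  of the group need not act on a given cone by a single prefix replacement.\<close>

definition maps_cone :: "(nat stream \<Rightarrow> nat stream) \<Rightarrow> nat list \<Rightarrow> nat list \<Rightarrow> bool" where
  "maps_cone f u v \<longleftrightarrow> (\<forall>w\<in>C. f (u @- w) = v @- w)"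

lemma words_simps [simp]:
  "[] \<in> words" "a # u \<in> words \<longleftrightarrow> a < n \<and> u \<in> words" "u @ v \<in> words \<longleftrightarrow> u \<in> words \<and> v \<in> words"
  by (auto simp: words_def)

lemma shift_in_C [simp]: "u @- w \<in> C \<longleftrightarrow> u \<in> words \<and> w \<in> C"
  by (auto simp: cantor_space_def streams_iff_sset words_def)

lemma zeros_in_C [simp]: "sconst 0 \<in> C"
  using two_le by (auto simp: cantor_space_def streams_iff_sset)

lemma in_coneI: "w \<in> C \<Longrightarrow> u @- w \<in> cone n u"
  by (auto simp: cone_def)

lemma in_coneE:
  assumes "x \<in> cone n u"
  obtains w where "x = u @- w" "w \<in> C"
  using assms by (auto simp: cone_def)

lemma level_split:
  assumes "x \<in> C"
  obtains u w where "x = u @- w" "u \<in> level m" "w \<in> C"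
proof -
  have "stake m x @- sdrop m x \<in> C" using assms by (simp only: stake_sdrop)
  then have "stake m x \<in> words" "sdrop m x \<in> C" by (simp_all only: shift_in_C)
  then show ?thesis
    by (intro that[of "stake m x" "sdrop m x"]) (simp_all add: stake_sdrop level_def)
qed

lemma levelD: "u \<in> level m \<Longrightarrow> u \<in> words" "u \<in> level m \<Longrightarrow> length u = m"
  by (auto simp: level_def)

lemma finite_level [simp]: "finite (level m)"
  using finite_lists_length_eq[of "{..<n}" m] by (simp add: level_def words_def lists_eq_set)

lemma card_level: "card (level m) = n ^ m"
  using card_lists_length_eq[of "{..<n}" m] by (simp add: level_def words_def lists_eq_set)

lemma maps_coneD: "maps_cone f u v \<Longrightarrow> w \<in> C \<Longrightarrow> f (u @- w) = v @- w"
  by (simp add: maps_cone_def)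

lemma maps_cone_append: "maps_cone f u v \<Longrightarrow> t \<in> words \<Longrightarrow> maps_cone f (u @ t) (v @ t)"
  by (simp add: maps_cone_def)

lemma parallel_cones_disjoint: "u \<parallel> v \<Longrightarrow> cone n u \<inter> cone n v = {}"
  by (auto simp: cone_def dest: parallel_shift_neq)

lemma prefix_of_cone:
  assumes "x \<in> cone n u" "x \<in> cone n v" "length u \<le> length v"
  shows "prefix u v"
proof -
  obtain w w' where "x = u @- w" "x = v @- w'"
    using assms(1,2) by (meson in_coneE)
  then show ?thesis
    using shift_eq_shiftD[of u w v w'] assms(3) by auto
qed

lemma cone_nonempty [simp]: "cone n u \<noteq> {}"
  using in_coneI[OF zeros_in_C] by blast

lemma cantor_basisI:
  assumes "finite A" "A \<subseteq> words" "\<Union> (cone n ` A) = C"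
    and "\<And>u v. u \<in> A \<Longrightarrow> v \<in> A \<Longrightarrow> u \<noteq> v \<Longrightarrow> cone n u \<inter> cone n v = {}"
  shows "cantor_basis n A"
proof -
  have "disjoint (cone n ` A)"
  proof (rule disjointI)
    fix p q assume "p \<in> cone n ` A" "q \<in> cone n ` A" "p \<noteq> q"
    then show "p \<inter> q = {}" using assms(4) by (metis imageE)
  qed
  moreover have "{} \<notin> cone n ` A" using cone_nonempty by (metis imageE)
  ultimately show ?thesis using assms(1-3) by (simp add: cantor_basis_def partition_on_def words_def)
qed

lemma carrierI:
  assumes "f \<in> Bij C" "cantor_basis n A" "cantor_basis n B" "bij_betw \<sigma> A B"
    and "\<And>u w. u \<in> A \<Longrightarrow> w \<in> C \<Longrightarrow> f (u @- w) = \<sigma> u @- w"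
  shows "f \<in> carrier G"
proof -
  have "\<exists>A B \<sigma>. cantor_basis n A \<and> cantor_basis n B \<and> bij_betw \<sigma> A B \<and>
      (\<forall>u\<in>A. \<forall>w\<in>C. f (u @- w) = \<sigma> u @- w)"
    using assms(2-5) by metis
  then show ?thesis using assms(1) by (simp add: G_def higman_thompson_def)
qed

text \<open>Replaces the two bases by one length. Once \<open>m\<close> is the maximal length in
  \<open>A\<close>, every word of length \<open>m\<close> extends a word of \<open>A\<close>.
  Conversely the words of length \<open>m\<close> form a basis, and so do their images because
  \<open>f\<close> is bijective.\<close>

lemma carrier_eq:
  "carrier G = {f \<in> Bij C. \<exists>m. \<forall>u\<in>level m. \<exists>v\<in>words. maps_cone f u v}" (is "_ = ?R")
proof (intro equalityI subsetI)
  fix f assume "f \<in> carrier G"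
  then obtain A B \<sigma> where f: "f \<in> Bij C" "cantor_basis n A" "cantor_basis n B" "bij_betw \<sigma> A B"
    and map: "\<forall>u\<in>A. \<forall>w\<in>C. f (u @- w) = \<sigma> u @- w"
    by (auto simp: G_def higman_thompson_def)
  have fin: "finite A" and A: "A \<subseteq> words" and un: "\<Union> (cone n ` A) = C"
    using f(2) by (auto simp: cantor_basis_def partition_on_def words_def)
  define m where "m = Max (length ` A)"
  have "\<exists>v\<in>words. maps_cone f u v" if u: "u \<in> level m" for u
  proof -
    have "u @- sconst 0 \<in> \<Union> (cone n ` A)" using u by (simp add: un levelD)
    then obtain a where a: "a \<in> A" "u @- sconst 0 \<in> cone n a" by auto
    have "length a \<le> length u" using a fin u by (simp add: m_def levelD)
    then have "prefix a u" using a prefix_of_cone[of "u @- sconst 0" a u] in_coneI by simp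
    then obtain t where t: "u = a @ t" by (auto elim: prefixE)
    have "\<sigma> a \<in> B" using a f(4) by (auto simp: bij_betw_def)
    then have "\<sigma> a @ t \<in> words" using f(3) u t by (auto simp: cantor_basis_def level_def words_def)
    moreover have "maps_cone f u (\<sigma> a @ t)" unfolding t
      using a map u t by (intro maps_cone_append) (auto simp: maps_cone_def level_def)
    ultimately show ?thesis by blast
  qed
  then show "f \<in> ?R" using f(1) by blast
next
  fix f assume "f \<in> ?R"
  then obtain m where f: "f \<in> Bij C" and "\<forall>u\<in>level m. \<exists>v\<in>words. maps_cone f u v" by blast
  then obtain \<sigma> where \<sigma>: "\<And>u. u \<in> level m \<Longrightarrow> \<sigma> u \<in> words \<and> maps_cone f u (\<sigma> u)" by metis
  have inj: "inj_on f C" and surj: "f ` C = C" using f by (auto simp: Bij_def bij_betw_def)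
  have img: "cone n (\<sigma> u) = f ` cone n u" if "u \<in> level m" for u
    using \<sigma>[OF that] by (force simp: cone_def maps_cone_def)
  have sub: "cone n u \<subseteq> C" if "u \<in> level m" for u
    using that by (auto simp: cone_def levelD)
  have disj: "cone n u \<inter> cone n v = {}" if "u \<in> level m" "v \<in> level m" "u \<noteq> v" for u v
    using that by (intro parallel_cones_disjoint not_equal_is_parallel) (auto simp: levelD)
  have cover: "\<Union> (cone n ` level m) = C"
  proof (intro equalityI subsetI)
    fix x assume "x \<in> C"
    then show "x \<in> \<Union> (cone n ` level m)" by (rule level_split[of x m]) (auto intro: in_coneI)
  qed (use sub in auto)
  have disj': "cone n (\<sigma> u) \<inter> cone n (\<sigma> v) = {}" if "u \<in> level m" "v \<in> level m" "u \<noteq> v" for u v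
    using disj[OF that] inj_on_image_Int[OF inj sub[OF that(1)] sub[OF that(2)]]
    by (simp add: img that)
  have inj\<sigma>: "inj_on \<sigma> (level m)"
    using disj' cone_nonempty by (metis inf.idem inj_onI)
  have A: "cantor_basis n (level m)"
    using cover disj by (intro cantor_basisI finite_level) (auto simp: level_def)
  have "\<Union> (cone n ` \<sigma> ` level m) = f ` \<Union> (cone n ` level m)" by (auto simp: img)
  then have cover': "\<Union> (cone n ` \<sigma> ` level m) = C" using cover surj by simp
  have B: "cantor_basis n (\<sigma> ` level m)"
  proof (rule cantor_basisI)
    show "\<sigma> ` level m \<subseteq> words" using \<sigma> by blast
  qed (use cover' disj' in auto)
  show "f \<in> carrier G"
  proof (rule carrierI[OF f A B])
    show "bij_betw \<sigma> (level m) (\<sigma> ` level m)" using inj\<sigma> by (simp add: bij_betw_def)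
    show "f (u @- w) = \<sigma> u @- w" if "u \<in> level m" "w \<in> C" for u w
      using \<sigma>[OF that(1)] that(2) maps_coneD by blast
  qed
qed

section \<open>Group structure\<close>

lemma mult_eq: "f \<otimes> g = compose C g f"
  by (simp add: G_def higman_thompson_def)

lemma one_eq: "\<one> = (\<lambda>w\<in>C. w)"
  by (simp add: G_def higman_thompson_def)

lemma mult_apply [simp]: "x \<in> C \<Longrightarrow> (f \<otimes> g) x = g (f x)"
  by (simp add: mult_eq compose_def)

lemma one_apply [simp]: "x \<in> C \<Longrightarrow> \<one> x = x"
  by (simp add: one_eq)

lemma carrier_Bij: "f \<in> carrier G \<Longrightarrow> f \<in> Bij C"
  by (simp add: carrier_eq)

lemma apply_in_C [simp]: "f \<in> carrier G \<Longrightarrow> x \<in> C \<Longrightarrow> f x \<in> C"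
  using carrier_Bij Bij_imp_funcset by blast

lemma carrier_inj: "f \<in> carrier G \<Longrightarrow> x \<in> C \<Longrightarrow> y \<in> C \<Longrightarrow> f x = f y \<Longrightarrow> x = y"
  using carrier_Bij[of f] by (auto simp: Bij_def bij_betw_def inj_on_def)

lemma carrier_ext:
  assumes "f \<in> carrier G" "g \<in> carrier G" "\<And>x. x \<in> C \<Longrightarrow> f x = g x"
  shows "f = g"
  using assms(1,2)[THEN carrier_Bij] assms(3) by (auto intro: extensionalityI simp: Bij_def)

lemma maps_cone_word:
  assumes "f \<in> carrier G" "maps_cone f u v" "u \<in> words"
  shows "v \<in> words"
proof -
  have "f (u @- sconst 0) \<in> C" using assms by simp
  then show ?thesis using assms(2) by (simp add: maps_coneD)
qed

text \<open>A replacement defined on words of length \<open>m\<close> can shorten a word by at most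
  \<open>m\<close> letters. This bound makes composition work and later keeps images above a
  prescribed length.\<close>

lemma maps_cone_refine:
  assumes "\<And>u. u \<in> level m \<Longrightarrow> \<exists>v\<in>words. maps_cone f u v" "m \<le> length u" "u \<in> words"
  shows "\<exists>v\<in>words. maps_cone f u v \<and> length u \<le> length v + m"
proof -
  have *: "take m u \<in> words" "drop m u \<in> words"
    using assms(3) words_simps(3)[of "take m u" "drop m u"] by simp_all
  then have "take m u \<in> level m" using assms(2) by (auto simp: level_def)
  then obtain v where "v \<in> words" "maps_cone f (take m u) v" using assms(1) by blast
  then have "maps_cone f (take m u @ drop m u) (v @ drop m u)" "v @ drop m u \<in> words"
    using * by (auto intro!: maps_cone_append simp del: append_take_drop_id)
  then show ?thesis using assms(2) by (intro bexI[of _ "v @ drop m u"]) simp_all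
qed

lemma mult_closed:
  assumes f: "f \<in> carrier G" and g: "g \<in> carrier G"
  shows "f \<otimes> g \<in> carrier G"
proof -
  obtain k where k: "\<And>u. u \<in> level k \<Longrightarrow> \<exists>v\<in>words. maps_cone f u v"
    using f by (auto simp: carrier_eq)
  obtain m where m: "\<And>u. u \<in> level m \<Longrightarrow> \<exists>v\<in>words. maps_cone g u v"
    using g by (auto simp: carrier_eq)
  have "\<exists>w\<in>words. maps_cone (f \<otimes> g) u w" if u: "u \<in> level (k + m)" for u
  proof -
    obtain v where v: "v \<in> words" "maps_cone f u v" "length u \<le> length v + k"
      using maps_cone_refine[OF k, where u = u] u by (force simp: level_def)
    then have "m \<le> length v" using u by (simp add: levelD)
    then obtain w where w: "w \<in> words" "maps_cone g v w"
      using maps_cone_refine[OF m \<open>m \<le> length v\<close> v(1)] by blast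
    then have "maps_cone (f \<otimes> g) u w" using v u by (simp add: maps_cone_def levelD)
    then show ?thesis using w by blast
  qed
  moreover have "f \<otimes> g \<in> Bij C" using f g by (simp add: mult_eq carrier_Bij compose_Bij)
  ultimately show ?thesis by (auto simp: carrier_eq)
qed

text \<open>The description by two bases is the convenient one here: it is symmetric, so the inverse
  merely exchanges \<open>A\<close> and \<open>B\<close>, whereas the images of a level need not
  form a level.\<close>

lemma ex_inverse:
  assumes f: "f \<in> carrier G"
  shows "\<exists>g\<in>carrier G. g \<otimes> f = \<one>"
proof -
  obtain A B \<sigma> where *: "f \<in> Bij C" "cantor_basis n A" "cantor_basis n B" "bij_betw \<sigma> A B"
    and map: "\<forall>u\<in>A. \<forall>w\<in>C. f (u @- w) = \<sigma> u @- w"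
    using f by (auto simp: G_def higman_thompson_def)
  define g where "g = (\<lambda>x\<in>C. inv_into C f x)"
  have inj: "inj_on f C" and surj: "f ` C = C" using *(1) by (auto simp: Bij_def bij_betw_def)
  have "g (u @- w) = inv_into A \<sigma> u @- w" if u: "u \<in> B" and w: "w \<in> C" for u w
  proof -
    obtain a where a: "a \<in> A" "u = \<sigma> a" using *(4) u by (auto simp: bij_betw_def)
    have "a \<in> words" "u \<in> words" using *(2,3) a u by (auto simp: cantor_basis_def words_def)
    moreover have "inv_into A \<sigma> u = a" using *(4) a by (simp add: bij_betw_inv_into_left)
    moreover have "u @- w = f (a @- w)" using map a w by simp
    moreover have "u @- w \<in> C" using \<open>u \<in> words\<close> w by simp
    ultimately show ?thesis using w inv_into_f_f[OF inj, of "a @- w"] by (simp add: g_def)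
  qed
  moreover have gB: "g \<in> Bij C" unfolding g_def using *(1) by (rule restrict_inv_into_Bij)
  ultimately have "g \<in> carrier G"
    using carrierI[OF _ *(3,2) bij_betw_inv_into[OF *(4)]] by blast
  moreover have "g \<otimes> f = \<one>" 
    unfolding mult_eq one_eq g_def using surj by (auto simp: compose_def f_inv_into_f intro!: restrict_ext)
  ultimately show ?thesis by blast
qed

sublocale group G
proof (rule groupI)
  show "\<one> \<in> carrier G"
    by (auto simp: one_eq carrier_eq id_Bij maps_cone_def level_def intro!: exI[of _ 0])
  then show "\<one> \<otimes> f = f" if "f \<in> carrier G" for f
    using that by (auto intro!: carrier_ext mult_closed)
  show "f \<otimes> g \<otimes> h = f \<otimes> (g \<otimes> h)"
    if "f \<in> carrier G" "g \<in> carrier G" "h \<in> carrier G" for f g h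
    using that by (auto intro!: carrier_ext mult_closed)
qed (use mult_closed ex_inverse in auto)

lemma inv_apply_apply [simp]:
  assumes "f \<in> carrier G" "x \<in> C"
  shows "(inv f) (f x) = x" "f ((inv f) x) = x"
  using r_inv[OF assms(1)] l_inv[OF assms(1)] assms by (metis mult_apply one_apply)+

lemma maps_cone_mult:
  "u \<in> words \<Longrightarrow> maps_cone f u v \<Longrightarrow> maps_cone g v w \<Longrightarrow> maps_cone (f \<otimes> g) u w"
  by (simp add: maps_cone_def)

lemma maps_cone_inv:
  assumes "f \<in> carrier G" "u \<in> words" "maps_cone f u v"
  shows "maps_cone (inv f) v u"
  unfolding maps_cone_def
proof
  fix w assume "w \<in> C"
  then have "v @- w = f (u @- w)" using assms by (simp add: maps_coneD)
  then show "(inv f) (v @- w) = u @- w" using assms \<open>w \<in> C\<close> by simp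
qed

text \<open>Comparable images would have a common extension, hence a point with two
  preimages.\<close>

lemma maps_cone_parallel:
  assumes f: "f \<in> carrier G" and u: "u \<in> words" "u' \<in> words" "u \<parallel> u'"
    and v: "maps_cone f u v" "maps_cone f u' v'"
  shows "v \<parallel> v'"
proof (rule ccontr)
  assume "\<not> v \<parallel> v'"
  then have "prefix v v' \<or> prefix v' v" by (auto simp: parallel_def)
  then obtain t t' where "v @ t = v' @ t'" "t \<in> words" "t' \<in> words"
    using maps_cone_word[OF f v(1) u(1)] maps_cone_word[OF f v(2) u(2)]
    by (metis append_Nil2 prefixE words_simps(1,3))
  moreover have "f (u @- t @- sconst 0) = (v @ t) @- sconst 0"
    using \<open>t \<in> words\<close> by (simp add: maps_coneD[OF v(1)])
  moreover have "f (u' @- t' @- sconst 0) = (v' @ t') @- sconst 0"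
    using \<open>t' \<in> words\<close> by (simp add: maps_coneD[OF v(2)])
  ultimately have "f (u @- t @- sconst 0) = f (u' @- t' @- sconst 0)" by simp
  then show False
    using carrier_inj[OF f, of "u @- t @- sconst 0" "u' @- t' @- sconst 0"]
      u parallel_shift_neq[OF u(3)] \<open>t \<in> words\<close> \<open>t' \<in> words\<close> by simp
qed

lemma cover_ext:
  assumes "f \<in> carrier G" "g \<in> carrier G"
    and "\<And>u. u \<in> U \<Longrightarrow> \<exists>v. maps_cone f u v \<and> maps_cone g u v"
    and "\<And>x. x \<in> C \<Longrightarrow> \<forall>u\<in>U. x \<notin> cone n u \<Longrightarrow> f x = g x"
  shows "f = g"
  using assms(1,2)
proof (rule carrier_ext)
  fix x assume x: "x \<in> C"
  show "f x = g x"
  proof (cases "\<exists>u\<in>U. x \<in> cone n u")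
    case True
    then obtain u w where u: "u \<in> U" and w: "x = u @- w" "w \<in> C" by (auto elim: in_coneE)
    then show ?thesis using assms(3)[OF u] by (auto simp: maps_cone_def)
  qed (use assms(4) x in blast)
qed

section \<open>Cyclic permutations of disjoint cones\<close>

definition code :: "nat list list \<Rightarrow> bool" where
  "code xs \<longleftrightarrow> set xs \<subseteq> words \<and> sorted_wrt (\<parallel>) xs"

text \<open>The entries of a code have disjoint cones, so the definite description is unambiguous.
  The empty list gives the identity, which later stands for an absent factor.\<close>

definition cyc :: "nat list list \<Rightarrow> nat stream \<Rightarrow> nat stream" where
  "cyc xs = (\<lambda>x\<in>C. if \<exists>i<length xs. x \<in> cone n (xs ! i)
     then let i = THE i. i < length xs \<and> x \<in> cone n (xs ! i)
       in xs ! (Suc i mod length xs) @- sdrop (length (xs ! i)) x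
     else x)"

lemma code_nth: "code xs \<Longrightarrow> i < length xs \<Longrightarrow> xs ! i \<in> words"
  by (auto simp: code_def subset_iff)

lemma cyc_nth:
  assumes "code xs" "i < length xs"
  shows "maps_cone (cyc xs) (xs ! i) (xs ! (Suc i mod length xs))"
  unfolding maps_cone_def
proof
  fix w assume w: "w \<in> C"
  let ?x = "xs ! i @- w"
  have "xs ! i \<in> words" using assms by (rule code_nth)
  then have x: "?x \<in> C" using w by simp
  have "j = i" if "j < length xs" "?x \<in> cone n (xs ! j)" for j
    using that sorted_wrt_parallel_nth[of xs j i] assms in_coneI[OF w]
      parallel_cones_disjoint[of "xs ! j" "xs ! i"] by (auto simp: code_def)
  then have the: "(THE j. j < length xs \<and> ?x \<in> cone n (xs ! j)) = i"
    using assms w in_coneI by (intro the_equality) auto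
  have ex: "\<exists>i<length xs. ?x \<in> cone n (xs ! i)" using assms w in_coneI by blast
  show "cyc xs ?x = xs ! (Suc i mod length xs) @- w"
    unfolding cyc_def restrict_apply'[OF x] if_P[OF ex] the Let_def by (simp add: sdrop_shift)
qed

lemma cyc_outside:
  assumes "x \<in> C" "\<forall>u\<in>set xs. x \<notin> cone n u"
  shows "cyc xs x = x"
  using assms by (auto simp: cyc_def)

lemma cyc_parallel:
  assumes "a \<in> words" "\<And>u. u \<in> set xs \<Longrightarrow> a \<parallel> u"
  shows "maps_cone (cyc xs) a a"
  unfolding maps_cone_def
proof
  fix w assume "w \<in> C"
  then show "cyc xs (a @- w) = a @- w"
    using assms parallel_cones_disjoint in_coneI by (intro cyc_outside) (auto, blast)
qed

lemma cyc_iterate: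
  assumes "code xs" "i < length xs" "w \<in> C"
  shows "(cyc xs ^^ k) (xs ! i @- w) = xs ! ((i + k) mod length xs) @- w"
proof (induction k)
  case (Suc k)
  then show ?case
    using assms cyc_nth[OF assms(1), of "(i + k) mod length xs"] mod_less_divisor[of "length xs" "i + k"]
    by (fastforce simp: maps_cone_def mod_Suc_eq)
qed (use assms in simp)

lemma cyc_iterate_length:
  assumes "code xs" "x \<in> C"
  shows "(cyc xs ^^ length xs) x = x"
proof (cases "\<exists>u\<in>set xs. x \<in> cone n u")
  case True
  then obtain i w where "i < length xs" "x = xs ! i @- w" "w \<in> C"
    by (metis in_coneE in_set_conv_nth)
  then show ?thesis using cyc_iterate[OF assms(1), of i w "length xs"] by simp
next
  case False
  then have "cyc xs x = x" using assms cyc_outside by blast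
  then have "(cyc xs ^^ k) x = x" for k by (induction k) auto
  then show ?thesis .
qed

lemma cyc_in_C:
  assumes "code xs" "x \<in> C"
  shows "cyc xs x \<in> C"
proof (cases "\<exists>u\<in>set xs. x \<in> cone n u")
  case True
  then obtain i w where *: "i < length xs" "x = xs ! i @- w" "w \<in> C"
    by (metis in_coneE in_set_conv_nth)
  then have "Suc i mod length xs < length xs" by (intro mod_less_divisor) auto
  with * show ?thesis using cyc_nth[OF assms(1), of i] assms code_nth by (auto simp: maps_cone_def)
qed (use assms cyc_outside in force)

lemma cyc_carrier [simp]:
  assumes "code xs"
  shows "cyc xs \<in> carrier G"
proof -
  have pow: "(cyc xs ^^ k) x \<in> C" if "x \<in> C" for k x
    using that by (induction k) (auto simp: cyc_in_C assms)
  define k where "k = length xs - 1"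
  have k: "(cyc xs ^^ k) (cyc xs x) = x \<and> cyc xs ((cyc xs ^^ k) x) = x" if "x \<in> C" for x
  proof (cases "xs = []")
    case True
    then show ?thesis using cyc_outside[of x xs] that by (simp add: k_def)
  next
    case False
    then have "length xs = Suc k" by (simp add: k_def)
    then show ?thesis using cyc_iterate_length[OF assms that] by (simp add: funpow_swap1)
  qed
  have "bij_betw (cyc xs) C C"
    by (rule bij_betw_byWitness[where f' = "cyc xs ^^ k"]) (use k pow cyc_in_C assms in auto)
  then have bij: "cyc xs \<in> Bij C" by (auto simp: Bij_def cyc_def)
  \<comment> \<open>A word of this length extends an entry of \<open>xs\<close> or is incomparable
    to all of them; the inserted 0 is for the empty list.\<close>
  define m where "m = Max (insert 0 (length ` set xs))"
  have "\<exists>v\<in>words. maps_cone (cyc xs) u v" if u: "u \<in> level m" for u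
  proof (cases "\<exists>i<length xs. prefix (xs ! i) u")
    case True
    then obtain i t where i: "i < length xs" "u = xs ! i @ t" by (auto simp: prefix_def)
    then have t: "t \<in> words" using u by (auto simp: level_def)
    have "Suc i mod length xs < length xs" using i by (intro mod_less_divisor) auto
    then have "xs ! (Suc i mod length xs) @ t \<in> words" using code_nth[OF assms] t by auto
    moreover have "maps_cone (cyc xs) u (xs ! (Suc i mod length xs) @ t)"
      unfolding i(2) by (intro maps_cone_append cyc_nth assms i t)
    ultimately show ?thesis by blast
  next
    case False
    have "u \<parallel> v" if v: "v \<in> set xs" for v
    proof -
      have "\<not> prefix v u" using False v by (metis in_set_conv_nth)
      moreover have "length v \<le> length u" using v u by (auto simp: m_def levelD)
      ultimately show ?thesis
        by (metis parallelI prefix_length_prefix prefix_order.refl)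
    qed
    then show ?thesis using cyc_parallel u levelD by blast
  qed
  then show ?thesis using bij by (auto simp: carrier_eq)
qed

lemma pow_apply: "f \<in> carrier G \<Longrightarrow> x \<in> C \<Longrightarrow> (f [^] k) x = (f ^^ k) x" for k :: nat
  by (induction k) simp_all

lemma cyc_pow_length:
  assumes "code xs"
  shows "cyc xs [^] length xs = \<one>"
  by (rule carrier_ext) (use assms in \<open>auto simp: pow_apply cyc_iterate_length\<close>)

text \<open>Products apply the left factor first: \<open>inv f\<close> takes a point from a cone of
  \<open>ys\<close> back to the matching cone of \<open>xs\<close>, the cycle moves it on, and
  \<open>f\<close> returns it. Conjugation thus relabels the words of a cycle.\<close>

lemma cyc_conj:
  assumes f: "f \<in> carrier G" and xs: "code xs" and map2: "list_all2 (maps_cone f) xs ys"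
  shows "code ys" "inv f \<otimes> cyc xs \<otimes> f = cyc ys"
proof -
  have len: "length ys = length xs" using map2 by (simp add: list_all2_lengthD)
  have map: "maps_cone f (xs ! i) (ys ! i)" if "i < length xs" for i
    using map2 that by (rule list_all2_nthD)
  show ys: "code ys"
    unfolding code_def
  proof
    show "set ys \<subseteq> words"
    proof
      fix y assume "y \<in> set ys"
      then obtain i where "i < length ys" "y = ys ! i" by (metis in_set_conv_nth)
      then show "y \<in> words" using maps_cone_word[OF f map, of i] code_nth[OF xs] len by simp
    qed
    show "sorted_wrt (\<parallel>) ys"
      unfolding sorted_wrt_iff_nth_less
    proof (intro allI impI)
      fix i j assume ij: "i < j" "j < length ys"
      have "xs ! i \<parallel> xs ! j" using ij xs len by (simp add: code_def sorted_wrt_iff_nth_less)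
      then show "ys ! i \<parallel> ys ! j"
        using maps_cone_parallel[OF f _ _ _ map map, of i j] code_nth[OF xs] ij len by auto
    qed
  qed
  show "inv f \<otimes> cyc xs \<otimes> f = cyc ys"
  proof (rule cover_ext[where U = "set ys"])
    fix u assume "u \<in> set ys"
    then obtain i where i: "i < length xs" "u = ys ! i" using len by (metis in_set_conv_nth)
    have j: "Suc i mod length xs < length xs" using i by (intro mod_less_divisor) auto
    have "maps_cone (inv f \<otimes> cyc xs \<otimes> f) u (ys ! (Suc i mod length xs))"
      using maps_cone_mult[OF _ maps_cone_mult[OF _ maps_cone_inv[OF f _ map] cyc_nth] map]
        i j code_nth[OF xs] code_nth[OF ys] xs len by simp
    then show "\<exists>v. maps_cone (inv f \<otimes> cyc xs \<otimes> f) u v \<and> maps_cone (cyc ys) u v"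
      using cyc_nth[OF ys, of i] i len by auto
  next
    fix x assume x: "x \<in> C" "\<forall>u\<in>set ys. x \<notin> cone n u"
    have "(inv f) x \<notin> cone n u" if "u \<in> set xs" for u
    proof
      assume "(inv f) x \<in> cone n u"
      moreover obtain i where i: "i < length xs" "u = xs ! i" using \<open>u \<in> set xs\<close> by (metis in_set_conv_nth)
      ultimately obtain w where "(inv f) x = xs ! i @- w" "w \<in> C" by (auto elim: in_coneE)
      then have "x = ys ! i @- w" using map[OF i(1)] inv_apply_apply(2)[OF f x(1)] by (simp add: maps_coneD)
      then show False using x(2) i len \<open>w \<in> C\<close> in_coneI by (metis nth_mem)
    qed
    then have "cyc xs ((inv f) x) = (inv f) x" using f x by (intro cyc_outside) auto
    then show "(inv f \<otimes> cyc xs \<otimes> f) x = cyc ys x" using f x cyc_outside[of x ys] by auto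
  qed (use f xs ys in auto)
qed

text \<open>Conjugating the first cycle by the second relabels each of its words by itself.\<close>

lemma cyc_commute:
  assumes "code xs" "code ys" "\<And>x y. x \<in> set xs \<Longrightarrow> y \<in> set ys \<Longrightarrow> x \<parallel> y"
  shows "cyc xs \<otimes> cyc ys = cyc ys \<otimes> cyc xs"
proof -
  have "inv (cyc ys) \<otimes> cyc xs \<otimes> cyc ys = cyc xs"
    using assms by (intro cyc_conj(2) list.rel_refl_strong cyc_parallel) (auto simp: code_def)
  then have "cyc ys \<otimes> (inv (cyc ys) \<otimes> (cyc xs \<otimes> cyc ys)) = cyc ys \<otimes> cyc xs"
    using assms by (simp add: m_assoc)
  then show ?thesis using assms by (simp flip: m_assoc)
qed

section \<open>Antichains all of whose 3-cycles lie in a subgroup\<close>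

lemma code2 [simp]: "code [a, b] \<longleftrightarrow> a \<in> words \<and> b \<in> words \<and> a \<parallel> b"
  by (auto simp: code_def)

lemma code3 [simp]:
  "code [a, b, c] \<longleftrightarrow> a \<in> words \<and> b \<in> words \<and> c \<in> words \<and> a \<parallel> b \<and> a \<parallel> c \<and> b \<parallel> c"
  by (auto simp: code_def)

lemma cyc2_maps:
  assumes "code [a, b]"
  shows "maps_cone (cyc [a, b]) a b" "maps_cone (cyc [a, b]) b a"
  using cyc_nth[OF assms, of 0] cyc_nth[OF assms, of 1] by simp_all

lemma cyc3_maps:
  assumes "code [a, b, c]"
  shows "maps_cone (cyc [a, b, c]) a b" "maps_cone (cyc [a, b, c]) b c" "maps_cone (cyc [a, b, c]) c a"
  using cyc_nth[OF assms, of 0] cyc_nth[OF assms, of 1] cyc_nth[OF assms, of 2]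
  by (simp_all add: numeral_2_eq_2)

lemma maps_cone_one [simp]: "u \<in> words \<Longrightarrow> maps_cone \<one> u u"
  by (simp add: maps_cone_def)

lemma cyc3_rotate:
  assumes "code [a, b, c]"
  shows "cyc [b, c, a] = cyc [a, b, c]"
proof -
  have "inv (cyc [a, b, c]) \<otimes> cyc [a, b, c] \<otimes> cyc [a, b, c] = cyc [b, c, a]"
    using cyc3_maps[OF assms] by (intro cyc_conj(2)[OF cyc_carrier[OF assms] assms]) simp_all
  then show ?thesis using assms by (simp add: l_inv)
qed

lemma cyc3_reverse:
  assumes "code [a, b, c]"
  shows "cyc [c, b, a] = inv (cyc [a, b, c])"
proof -
  have rev: "code [c, b, a]" using assms parallel_commute by auto
  have "cyc [c, b, a] \<otimes> cyc [a, b, c] = \<one>"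
  proof (rule cover_ext[where U = "{a, b, c}"])
    show "\<exists>v. maps_cone (cyc [c, b, a] \<otimes> cyc [a, b, c]) u v \<and> maps_cone \<one> u v" if "u \<in> {a, b, c}" for u
      using that assms cyc3_maps[OF assms] cyc3_maps[OF rev]
      by (intro exI[of _ u]) (auto intro: maps_cone_mult)
    show "(cyc [c, b, a] \<otimes> cyc [a, b, c]) x = \<one> x" if "x \<in> C" "\<forall>u\<in>{a, b, c}. x \<notin> cone n u" for x
      using that cyc_outside[OF that(1), of "[a, b, c]"] cyc_outside[OF that(1), of "[c, b, a]"] by auto
  qed (use rev assms in simp_all)
  then show ?thesis using rev assms by (metis cyc_carrier inv_equality)
qed

section \<open>Generating all 3-cycles of an antichain\<close>

definition antichain :: "nat list set \<Rightarrow> bool" where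
  "antichain S \<longleftrightarrow> finite S \<and> S \<subseteq> words \<and> pairwise (\<parallel>) S"

lemma antichainD:
  "antichain S \<Longrightarrow> a \<in> S \<Longrightarrow> a \<in> words"
  "antichain S \<Longrightarrow> a \<in> S \<Longrightarrow> b \<in> S \<Longrightarrow> a \<noteq> b \<Longrightarrow> a \<parallel> b"
  "antichain S \<Longrightarrow> finite S"
  by (auto simp: antichain_def pairwise_def)

lemma antichain_subset: "antichain S \<Longrightarrow> T \<subseteq> S \<Longrightarrow> antichain T"
  by (auto simp: antichain_def intro: finite_subset pairwise_subset)

lemma antichain_code3:
  "antichain S \<Longrightarrow> a \<in> S \<Longrightarrow> b \<in> S \<Longrightarrow> c \<in> S \<Longrightarrow> a \<noteq> b \<Longrightarrow> a \<noteq> c \<Longrightarrow> b \<noteq> c \<Longrightarrow> code [a, b, c]"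
  using antichainD by auto

lemma antichain_code: "antichain S \<Longrightarrow> distinct xs \<Longrightarrow> set xs \<subseteq> S \<Longrightarrow> code xs"
  by (auto simp: code_def antichain_def intro!: sorted_wrt_parallelI intro: pairwise_subset)

definition full :: "(nat stream \<Rightarrow> nat stream) set \<Rightarrow> nat list set \<Rightarrow> bool" where
  "full H S \<longleftrightarrow> (\<forall>a\<in>S. \<forall>b\<in>S. \<forall>c\<in>S. code [a, b, c] \<longrightarrow> cyc [a, b, c] \<in> H)"

lemma fullD: "full H S \<Longrightarrow> a \<in> S \<Longrightarrow> b \<in> S \<Longrightarrow> c \<in> S \<Longrightarrow> code [a, b, c] \<Longrightarrow> cyc [a, b, c] \<in> H"
  unfolding full_def by blast

lemma full_subset: "full H S \<Longrightarrow> T \<subseteq> S \<Longrightarrow> full H T"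
  unfolding full_def by blast

lemma cyc_conj_mem:
  assumes "subgroup H G" "f \<in> H" "cyc xs \<in> H" "code xs"
    and "list_all2 (maps_cone f) xs ys"
  shows "cyc ys \<in> H"
proof -
  have "f \<in> carrier G" using assms(1,2) subgroup.mem_carrier by metis
  then have "cyc ys = inv f \<otimes> cyc xs \<otimes> f" using cyc_conj(2) assms by simp
  then show ?thesis using assms(1-3) by (simp add: subgroup.m_closed subgroup.m_inv_closed)
qed

lemma cyc3_conj_mem:
  assumes "subgroup H G" "f \<in> H" "cyc [a, b, c] \<in> H" "code [a, b, c]"
    and "maps_cone f a a'" "maps_cone f b b'" "maps_cone f c c'"
  shows "cyc [a', b', c'] \<in> H"
  by (rule cyc_conj_mem[OF assms(1-4)]) (use assms in simp)

lemma cyc3_reverse_mem: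
  assumes "subgroup H G" "cyc [a, b, c] \<in> H" "code [a, b, c]"
  shows "cyc [c, b, a] \<in> H"
  using assms by (simp add: cyc3_reverse subgroup.m_inv_closed)

lemma cyc3_combine:
  assumes H: "subgroup H G" and S: "antichain S"
    and mem: "p \<in> S" "q \<in> S" "r \<in> S" "s \<in> S"
    and dist: "distinct [p, q, r, s]"
    and H3: "cyc [p, q, r] \<in> H" "cyc [p, q, s] \<in> H"
  shows "cyc [q, r, s] \<in> H"
proof -
  note code = antichain_code3[OF S]
  have 1: "code [p, q, r]" and 2: "code [p, q, s]" and 3: "code [q, s, r]" and 4: "code [r, s, q]"
    using code mem dist by auto
  have "maps_cone (cyc [p, q, s]) r r" using S mem dist by (intro cyc_parallel) (auto simp: antichainD)
  then have "cyc [q, s, r] \<in> H" by (rule cyc3_conj_mem[OF H H3(2) H3(1) 1 cyc3_maps(1,2)[OF 2]])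
  then have "cyc [r, s, q] \<in> H" using 3 by (rule cyc3_reverse_mem[OF H])
  moreover have "cyc [q, r, s] = cyc [r, s, q]" using cyc3_rotate[OF 4] cyc3_rotate[of s q r] 3 4
    parallel_commute by auto
  ultimately show ?thesis by simp
qed

text \<open>The alternating group is generated by the 3-cycles through a fixed pair. Applying
  \<open>cyc3_combine\<close> removes first one and then both of \<open>x\<close>, \<open>y\<close>
  from the cycle; inverses and rotations give the remaining positions.\<close>

lemma full_star:
  assumes H: "subgroup H G" and S: "antichain S" and xy: "x \<in> S" "y \<in> S" "x \<noteq> y"
    and star: "\<And>z. z \<in> S \<Longrightarrow> z \<noteq> x \<Longrightarrow> z \<noteq> y \<Longrightarrow> cyc [x, y, z] \<in> H"
  shows "full H S"
proof -
  note code = antichain_code3[OF S]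
  have rot: "cyc [b, c, a] \<in> H" if "cyc [a, b, c] \<in> H" "code [a, b, c]" for a b c
    using that by (simp add: cyc3_rotate)
  have star': "cyc [y, x, z] \<in> H" if "z \<in> S" "z \<noteq> x" "z \<noteq> y" for z
    using rot[OF cyc3_reverse_mem[OF H star[OF that]]] code xy that by blast
  have y: "cyc [y, z, w] \<in> H" if "z \<in> S" "w \<in> S" "distinct [x, y, z, w]" for z w
    using cyc3_combine[OF H S xy(1,2) that(1,2) that(3) star star] that by auto
  have x: "cyc [x, z, w] \<in> H" if "z \<in> S" "w \<in> S" "distinct [x, y, z, w]" for z w
    using cyc3_combine[OF H S xy(2,1) that(1,2) _ star' star'] that by auto
  have o: "cyc [z, w, v] \<in> H" if "z \<in> S" "w \<in> S" "v \<in> S" "distinct [x, y, z, w, v]" for z w v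
    using cyc3_combine[OF H S xy(2) that(1-3) _ y y] that by auto
  have front: "cyc [a, b, c] \<in> H" if m: "a \<in> S" "b \<in> S" "c \<in> S" "distinct [a, b, c]" and a: "a = x \<or> a = y" for a b c
  proof -
    consider "a = x" "b = y" | "a = y" "b = x" | "a = x" "c = y" | "a = y" "c = x"
      | "a = x" "b \<noteq> y" "c \<noteq> y" | "a = y" "b \<noteq> x" "c \<noteq> x" using a by blast
    then show ?thesis
    proof cases
      case 3
      then have "cyc [y, x, b] \<in> H" "code [y, x, b]" using m xy 3 star'[of b] code[of y x b] by auto
      then show ?thesis using 3 rot by blast
    next
      case 4
      then have "cyc [x, y, b] \<in> H" "code [x, y, b]" using m xy 4 star[of b] code[of x y b] by auto
      then show ?thesis using 4 rot by blast
    qed (use m star star' x y xy in auto)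
  qed
  show ?thesis
    unfolding full_def
  proof (intro ballI impI)
    fix a b c assume m: "a \<in> S" "b \<in> S" "c \<in> S" "code [a, b, c]"
    then have d: "distinct [a, b, c]" by auto
    consider "a = x \<or> a = y" | "b = x \<or> b = y" | "c = x \<or> c = y" | "distinct [x, y, a, b, c]"
      using d xy by auto
    then show "cyc [a, b, c] \<in> H"
    proof cases
      case 2
      then have "cyc [b, c, a] \<in> H" using d m by (intro front) auto
      then show ?thesis using cyc3_rotate[OF m(4)] by simp
    next
      case 3
      then have "cyc [c, a, b] \<in> H" using d m by (intro front) auto
      then show ?thesis using rot[of c a b] code[of c a b] m d by auto
    qed (use front o d m in auto)
  qed
qed

text \<open>Each of \<open>S\<close> and \<open>T\<close> supplies its part of the star over the
  common pair \<open>x\<close>, \<open>y\<close>.\<close>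

lemma full_Un:
  assumes "subgroup H G" "antichain (S \<union> T)" "full H S" "full H T"
    and "x \<in> S \<inter> T" "y \<in> S \<inter> T" "x \<noteq> y"
  shows "full H (S \<union> T)"
proof (rule full_star[OF assms(1,2)])
  fix z assume "z \<in> S \<union> T" "z \<noteq> x" "z \<noteq> y"
  then have "code [x, y, z]" using assms(5-7) by (intro antichain_code3[OF assms(2)]) auto
  then show "cyc [x, y, z] \<in> H" using fullD[OF assms(3)] fullD[OF assms(4)] \<open>z \<in> S \<union> T\<close> assms(5,6) by blast
qed (use assms in auto)

lemma full_transport:
  assumes H: "subgroup H G" and f: "f \<in> H" and S: "full H S" "S \<subseteq> words"
    and T: "\<And>t. t \<in> T \<Longrightarrow> \<exists>s\<in>S. maps_cone f s t"
  shows "full H T"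
  unfolding full_def
proof (intro ballI impI)
  fix a b c assume "a \<in> T" "b \<in> T" "c \<in> T" and code: "code [a, b, c]"
  then obtain a' b' c' where *: "a' \<in> S" "b' \<in> S" "c' \<in> S"
    and map: "maps_cone f a' a" "maps_cone f b' b" "maps_cone f c' c" using T by metis
  have fG: "f \<in> carrier G" using H f subgroup.mem_carrier by metis
  have w: "a' \<in> words" "b' \<in> words" "c' \<in> words" using * S(2) by auto
  have inv: "maps_cone (inv f) a a'" "maps_cone (inv f) b b'" "maps_cone (inv f) c c'"
    using maps_cone_inv[OF fG] w map by auto
  have fG': "inv f \<in> carrier G" using fG by simp
  have abc: "a \<in> words" "b \<in> words" "c \<in> words" "a \<parallel> b" "a \<parallel> c" "b \<parallel> c" using code by simp_all
  note par = maps_cone_parallel[OF fG']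
  have "code [a', b', c']"
    using w par[OF abc(1,2,4) inv(1,2)] par[OF abc(1,3,5) inv(1,3)] par[OF abc(2,3,6) inv(2,3)] by simp
  then show "cyc [a, b, c] \<in> H" using cyc3_conj_mem[OF H f fullD[OF S(1)]] * map by blast
qed

section \<open>Replacing a leaf by its children\<close>

definition expand :: "nat list set \<Rightarrow> nat list \<Rightarrow> nat list set" where
  "expand S c = (S - {c}) \<union> (\<lambda>i. c @ [i]) ` {..<n}"

lemma antichain_not_prefix: "antichain S \<Longrightarrow> a \<in> S \<Longrightarrow> b \<in> S \<Longrightarrow> prefix a b \<Longrightarrow> a = b"
  using antichainD(2) parallelD1 by blast

lemma parallel_append2: "a \<parallel> b \<Longrightarrow> a \<parallel> b @ c"
  using parallel_append[of a b "[]" c] by auto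

lemma antichain_expand:
  assumes S: "antichain S" and c: "c \<in> S"
  shows "antichain (expand S c)"
  unfolding antichain_def
proof (intro conjI)
  show "finite (expand S c)" using antichainD(3)[OF S] by (simp add: expand_def)
  show "expand S c \<subseteq> words" using antichainD(1)[OF S] c by (fastforce simp: expand_def)
  have 1: "a \<parallel> c @ [i]" "c @ [i] \<parallel> a" if "a \<in> S" "a \<noteq> c" for a i
    using antichainD(2)[OF S that(1) c that(2)] parallel_append2 parallel_commute by blast+
  have 2: "c @ [i] \<parallel> c @ [j]" if "i \<noteq> j" for i j
    using that by (intro not_equal_is_parallel) auto
  show "pairwise (\<parallel>) (expand S c)"
    using antichainD(2)[OF S] 1 2 unfolding pairwise_def expand_def by auto metis+
qed

text \<open>The 3-cycle \<open>(b d e)\<close> lies in \<open>H\<close>; it carries the children of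
  \<open>b\<close> to those of \<open>d\<close>, then \<open>d\<close> to \<open>e\<close> and
  \<open>e\<close> to \<open>b\<close>, hence one expansion onto the other.\<close>

lemma full_expand_transport:
  assumes H: "subgroup H G" and T: "antichain T" "full H T" "full H (expand T b)"
    and mem: "b \<in> T" "d \<in> T" "e \<in> T" "distinct [b, d, e]"
  shows "full H (expand T d)"
proof -
  have code: "code [b, d, e]" using mem by (intro antichain_code3[OF T(1)]) auto
  define f where "f = cyc [b, d, e]"
  have f: "f \<in> H" unfolding f_def by (intro fullD[OF T(2)] mem code)
  note map = cyc3_maps[OF code, folded f_def]
  show ?thesis
  proof (rule full_transport[OF H f T(3)])
    show "expand T b \<subseteq> words" using antichain_expand[OF T(1) mem(1)] by (auto simp: antichain_def)
    fix t assume t: "t \<in> expand T d"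
    then consider i where "i < n" "t = d @ [i]" | "t = b" | "t = e" | "t \<in> T" "t \<noteq> b" "t \<noteq> e" "t \<noteq> d"
      unfolding expand_def by auto
    then show "\<exists>s\<in>expand T b. maps_cone f s t"
    proof cases
      case 1
      then have "maps_cone f (b @ [i]) t" using maps_cone_append[OF map(1), of "[i]"] by simp
      then show ?thesis using 1 by (auto simp: expand_def)
    next
      case 2
      then show ?thesis using map(3) mem by (auto simp: expand_def)
    next
      case 3
      then show ?thesis using map(2) mem by (auto simp: expand_def)
    next
      case 4
      then have "maps_cone f t t" unfolding f_def using T(1) mem
        by (intro cyc_parallel) (auto simp: antichainD)
      then show ?thesis using 4 by (auto simp: expand_def)
    qed
  qed
qed

text \<open>The invariant of an induction: fullness of the single expansions is recorded along with
  that of \<open>S\<close>, which makes the property pass from \<open>S\<close> to its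
  expansions.\<close>

definition expansive :: "(nat stream \<Rightarrow> nat stream) set \<Rightarrow> nat list set \<Rightarrow> bool" where
  "expansive H S \<longleftrightarrow> antichain S \<and> 5 \<le> card S \<and> full H S \<and> (\<forall>c\<in>S. full H (expand S c))"

lemma expansiveI:
  assumes H: "subgroup H G" and S: "antichain S" "5 \<le> card S" "full H S"
    and b: "b \<in> S" "full H (expand S b)"
  shows "expansive H S"
  unfolding expansive_def
proof (intro conjI ballI S)
  fix d assume d: "d \<in> S"
  show "full H (expand S d)"
  proof (cases "d = b")
    case False
    have "\<not> S \<subseteq> {b, d}" using S(2) card_mono[of "{b, d}" S] False by auto
    then obtain e where "e \<in> S" "e \<noteq> b" "e \<noteq> d" by blast
    then show ?thesis using full_expand_transport[OF H S(1,3) b(2,1) d] False by auto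
  qed (use b in auto)
qed

text \<open>Expanding both \<open>b\<close> and \<open>c\<close> yields a union of parts of two
  single expansions of \<open>S\<close>. They share the words \<open>x\<close> and \<open>y\<close>,
  so gluing applies. By \<open>expansiveI\<close> this one expansion of \<open>expand S c\<close>
  spreads to all its leaves, the new ones included.\<close>

lemma expansive_expand:
  assumes H: "subgroup H G" and S: "expansive H S" and c: "c \<in> S"
  shows "expansive H (expand S c)"
proof -
  have S': "antichain S" "5 \<le> card S" "full H S" "\<And>c. c \<in> S \<Longrightarrow> full H (expand S c)"
    using S by (auto simp: expansive_def)
  have fin: "finite S" using S'(1) antichainD(3) by blast
  have c0: "c @ [0] \<notin> S" using antichain_not_prefix[OF S'(1) c] by fastforce
  have sub: "insert (c @ [0]) (S - {c}) \<subseteq> expand S c" using two_le by (auto simp: expand_def)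
  have ac: "antichain (expand S c)" by (rule antichain_expand[OF S'(1) c])
  have "card (insert (c @ [0]) (S - {c})) = card S"
    using card_Suc_Diff1[OF fin c] fin c0 by simp
  then have card: "5 \<le> card (expand S c)"
    using card_mono[OF antichainD(3)[OF ac] sub] S'(2) by simp
  have "\<not> S \<subseteq> {c}" using S'(2) card_mono[of "{c}" S] by auto
  then obtain b where b: "b \<in> S" "b \<noteq> c" by blast
  have "\<not> S \<subseteq> {b, c}" using S'(2) b card_mono[of "{b, c}" S] by auto
  then obtain x where x: "x \<in> S" "x \<noteq> b" "x \<noteq> c" by blast
  have "\<not> S \<subseteq> {b, c, x}" using S'(2) b x card_mono[of "{b, c, x}" S] by auto
  then obtain y where y: "y \<in> S" "y \<noteq> b" "y \<noteq> c" "y \<noteq> x" by blast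
  have bT: "b \<in> expand S c" using b by (simp add: expand_def)
  have "b \<noteq> c @ [i]" "c \<noteq> b @ [i]" for i
    using antichain_not_prefix[OF S'(1) c b(1)] antichain_not_prefix[OF S'(1) b(1) c] b by fastforce+
  then have eq: "expand (expand S c) b = (expand S c - {b}) \<union> (expand S b - {c})"
    using b by (auto simp: expand_def)
  have "full H ((expand S c - {b}) \<union> (expand S b - {c}))"
  proof (rule full_Un[OF H])
    show "antichain ((expand S c - {b}) \<union> (expand S b - {c}))"
      using antichain_expand[OF ac bT] by (simp add: eq)
    show "full H (expand S c - {b})" "full H (expand S b - {c})"
      using S'(4)[OF c] S'(4)[OF b(1)] full_subset by blast+
    show "x \<in> (expand S c - {b}) \<inter> (expand S b - {c})" "y \<in> (expand S c - {b}) \<inter> (expand S b - {c})"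
      using x y by (auto simp: expand_def)
  qed (use y in auto)
  then show ?thesis using expansiveI[OF H ac card S'(4)[OF c] bT] by (simp add: eq)
qed

text \<open>Expanding the leaves above \<open>a\<close>, \<open>b\<close>, \<open>c\<close> one at a time makes all three words leaves.\<close>

lemma expansive_cyc3:
  assumes H: "subgroup H G"
  shows "expansive H S \<Longrightarrow> x \<in> S \<Longrightarrow> y \<in> S \<Longrightarrow> z \<in> S \<Longrightarrow> code [x @ u, y @ v, z @ w] \<Longrightarrow>
    cyc [x @ u, y @ v, z @ w] \<in> H"
proof (induction "length u + length v + length w" arbitrary: S x y z u v w rule: less_induct)
  case less
  have step: "\<exists>p\<in>expand S c. \<exists>s. q @ t = p @ s \<and> length s \<le> length t \<and> (q = c \<longrightarrow> length s < length t)"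
    if "q \<in> S" "q @ t \<in> words" "c \<in> S" and ne: "q = c \<longrightarrow> t \<noteq> []" for q t c
  proof (cases "q = c")
    case True
    then obtain i s where t: "t = i # s" using ne by (meson neq_Nil_conv)
    then show ?thesis using that True by (intro bexI[of _ "c @ [i]"] exI[of _ s]) (auto simp: expand_def)
  qed (use that in \<open>auto simp: expand_def\<close>)
  have expand: ?case if c: "c \<in> S" and ne: "x = c \<longrightarrow> u \<noteq> []" "y = c \<longrightarrow> v \<noteq> []" "z = c \<longrightarrow> w \<noteq> []"
    and or: "x = c \<or> y = c \<or> z = c" for c
  proof -
    obtain x' u' where x': "x' \<in> expand S c" "x @ u = x' @ u'" "length u' \<le> length u" "x = c \<longrightarrow> length u' < length u"
      using step[OF less.prems(2) _ c ne(1)] less.prems(5) by auto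
    obtain y' v' where y': "y' \<in> expand S c" "y @ v = y' @ v'" "length v' \<le> length v" "y = c \<longrightarrow> length v' < length v"
      using step[OF less.prems(3) _ c ne(2)] less.prems(5) by auto
    obtain z' w' where z': "z' \<in> expand S c" "z @ w = z' @ w'" "length w' \<le> length w" "z = c \<longrightarrow> length w' < length w"
      using step[OF less.prems(4) _ c ne(3)] less.prems(5) by auto
    have "length u' + length v' + length w' < length u + length v + length w"
      using or x'(3,4) y'(3,4) z'(3,4) by linarith
    from less.hyps[OF this expansive_expand[OF H less.prems(1) c] x'(1) y'(1) z'(1)]
    show ?thesis using x'(2) y'(2) z'(2) less.prems(5) by simp
  qed
  have par: "x @ u \<parallel> y @ v" "x @ u \<parallel> z @ w" "y @ v \<parallel> z @ w" using less.prems(5) by auto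
  \<comment> \<open>Incomparable words that extend the same leaf are both different from it, so
    after its expansion each still extends a leaf.\<close>
  have ne: "x = y \<Longrightarrow> u \<noteq> [] \<and> v \<noteq> []" "x = z \<Longrightarrow> u \<noteq> [] \<and> w \<noteq> []" "y = z \<Longrightarrow> v \<noteq> [] \<and> w \<noteq> []"
    using par by (auto simp: parallel_def)
  consider "u \<noteq> []" | "v \<noteq> []" | "w \<noteq> []" | "u = []" "v = []" "w = []" by blast
  then show ?case
  proof cases
    case 1
    then show ?thesis using expand[OF less.prems(2)] ne by simp
  next
    case 2
    then show ?thesis using expand[OF less.prems(3)] ne by simp
  next
    case 3
    then show ?thesis using expand[OF less.prems(4)] ne by simp
  next
    case 4
    then show ?thesis using fullD[of H S] less.prems by (auto simp: expansive_def)
  qed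
qed

section \<open>Transpositions and permutations of a level\<close>

lemma full_cyc3:
  assumes "antichain S" "full H S" "a \<in> S" "b \<in> S" "c \<in> S" "a \<noteq> b" "a \<noteq> c" "b \<noteq> c"
  shows "cyc [a, b, c] \<in> H"
  using fullD[OF assms(2-5)] antichain_code3 assms by blast

lemma cyc2_square:
  assumes "code [a, b]"
  shows "cyc [a, b] \<otimes> cyc [a, b] = \<one>"
  using cyc_pow_length[OF assms] assms by (simp add: numeral_2_eq_2)

lemma cyc2_swap:
  assumes "code [a, b]"
  shows "cyc [b, a] = cyc [a, b]"
proof -
  have "inv (cyc [a, b]) \<otimes> cyc [a, b] \<otimes> cyc [a, b] = cyc [b, a]"
    using cyc2_maps[OF assms] by (intro cyc_conj(2)[OF cyc_carrier[OF assms] assms]) simp_all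
  then show ?thesis using assms by (simp add: l_inv)
qed

text \<open>The left factor acts first, so \<open>a\<close> goes to \<open>b\<close> and then to
  \<open>c\<close>.\<close>

lemma cyc2_mult:
  assumes "code [a, b, c]"
  shows "cyc [a, b] \<otimes> cyc [b, c] = cyc [a, c, b]"
proof -
  have c: "code [a, b]" "code [b, c]" "code [a, c, b]" using assms parallel_commute by auto
  have ac: "maps_cone (cyc [a, b]) c c" "maps_cone (cyc [b, c]) a a"
    using assms parallel_commute[of a c] parallel_commute[of b c] by (auto intro!: cyc_parallel)
  show ?thesis
  proof (rule cover_ext[where U = "{a, b, c}"])
    note m = cyc2_maps[OF c(1)] cyc2_maps[OF c(2)] cyc3_maps[OF c(3)] ac
    show "\<exists>v. maps_cone (cyc [a, b] \<otimes> cyc [b, c]) u v \<and> maps_cone (cyc [a, c, b]) u v"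
      if "u \<in> {a, b, c}" for u
    proof -
      have "maps_cone (cyc [a, b] \<otimes> cyc [b, c]) a c" "maps_cone (cyc [a, b] \<otimes> cyc [b, c]) b a"
        "maps_cone (cyc [a, b] \<otimes> cyc [b, c]) c b"
        using m assms by (auto intro: maps_cone_mult)
      then show ?thesis using that m by blast
    qed
    fix x assume x: "x \<in> C" "\<forall>u\<in>{a, b, c}. x \<notin> cone n u"
    then show "(cyc [a, b] \<otimes> cyc [b, c]) x = cyc [a, c, b] x"
      by (simp add: cyc_outside)
  qed (use c in simp_all)
qed

text \<open>Transpositions that share one word multiply to a 3-cycle. For disjoint pairs the square
  of \<open>(b c)\<close> is inserted in the middle, which gives two such products.\<close>

lemma full_cyc2_mult:
  assumes H: "subgroup H G" and S: "antichain S" "full H S"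
    and mem: "a \<in> S" "b \<in> S" "c \<in> S" "d \<in> S" "a \<noteq> b" "c \<noteq> d"
  shows "cyc [a, b] \<otimes> cyc [c, d] \<in> H"
proof -
  have code: "code [x, y]" if "x \<in> S" "y \<in> S" "x \<noteq> y" for x y
    using that antichainD[OF S(1)] by auto
  have swap: "cyc [x, y] = cyc [y, x]" if "x \<in> S" "y \<in> S" "x \<noteq> y" for x y
    using cyc2_swap[OF code[OF that(2,1)]] that by auto
  have share: "cyc [x, y] \<otimes> cyc [y, z] \<in> H" if m: "x \<in> S" "y \<in> S" "z \<in> S" "x \<noteq> y" "y \<noteq> z" for x y z
  proof (cases "x = z")
    case True
    then show ?thesis using cyc2_square[OF code[OF m(1,2,4)]] swap[OF m(1,2,4)] subgroup.one_closed[OF H] by simp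
  next
    case False
    have "code [x, y, z]" by (rule antichain_code3[OF S(1)]) (use m False in auto)
    then show ?thesis using cyc2_mult full_cyc3[OF S, of x z y] m False by simp
  qed
  consider "b = c" | "b = d" | "a = c" | "a = d" | "b \<noteq> c" "b \<noteq> d" "a \<noteq> c" "a \<noteq> d" by blast
  then show ?thesis
  proof cases
    case 5
    have "(cyc [a, b] \<otimes> cyc [b, c]) \<otimes> (cyc [b, c] \<otimes> cyc [c, d]) \<in> H"
      by (rule subgroup.m_closed[OF H share share]) (use mem 5 in auto)
    moreover have "(cyc [a, b] \<otimes> cyc [b, c]) \<otimes> (cyc [b, c] \<otimes> cyc [c, d])
        = cyc [a, b] \<otimes> (cyc [b, c] \<otimes> cyc [b, c]) \<otimes> cyc [c, d]"
      using code[OF mem(1,2,5)] code[OF mem(2,3) 5(1)] code[OF mem(3,4,6)] by (simp add: m_assoc)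
    ultimately show ?thesis
      using cyc2_square[OF code[OF mem(2,3) 5(1)]] code[OF mem(1,2,5)] by simp
  qed (use share swap mem in metis)+
qed

text \<open>The threshold is there because only words that extend a leaf of the antichain are
  controlled, and short words need not do so.\<close>

definition deep :: "nat \<Rightarrow> (nat stream \<Rightarrow> nat stream) set \<Rightarrow> bool" where
  "deep K H \<longleftrightarrow> (\<forall>a b c. code [a, b, c] \<longrightarrow> K \<le> length a \<longrightarrow> K \<le> length b \<longrightarrow> K \<le> length c \<longrightarrow>
     cyc [a, b, c] \<in> H)"

lemma deep_full: "deep K H \<Longrightarrow> \<forall>a\<in>S. K \<le> length a \<Longrightarrow> full H S"
  by (auto simp: deep_def full_def)

lemma level_antichain: "antichain (level m)"
  by (auto simp: antichain_def levelD pairwise_def intro!: not_equal_is_parallel)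

lemma level_cover: "x \<in> C \<Longrightarrow> \<exists>u\<in>level m. x \<in> cone n u"
  by (rule level_split[of x m]) (auto intro: in_coneI)

lemma deep_level_full: "deep K H \<Longrightarrow> K \<le> m \<Longrightarrow> full H (level m)"
  by (rule deep_full) (auto simp: levelD)

text \<open>A transposition is the product of \<open>n\<close> transpositions of children, so modulo \<open>H\<close> it is the
  \<open>n\<close>-th power of one of them.\<close>

lemma cyc2_parity:
  assumes H: "subgroup H G" and deep: "deep K H" and ab: "code [a, b]" "K \<le> length a" "K \<le> length b"
  shows "if even n then cyc [a, b] \<in> H else cyc [a, b] \<otimes> cyc [a @ [0], b @ [0]] \<in> H"
proof -
  define s where "s i = cyc [a @ [i], b @ [i]]" for i
  define S where "S = (\<lambda>i. a @ [i]) ` {..<n} \<union> (\<lambda>i. b @ [i]) ` {..<n}"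
  have par: "a @ [i] \<parallel> b @ [j]" "b @ [j] \<parallel> a @ [i]" for i j
    using ab(1) parallel_append[of a b "[i]" "[j]"] parallel_commute by auto
  have par': "c @ [i] \<parallel> c @ [j]" if "i \<noteq> j" for c and i j :: nat
    using that by (intro not_equal_is_parallel) auto
  have S: "antichain S" using ab(1) par par' by (auto simp: antichain_def S_def pairwise_def)
  have SH: "full H S" by (rule deep_full[OF deep]) (use ab in \<open>auto simp: S_def\<close>)
  have "a @ [i] \<noteq> b @ [i]" for i using par[of i i] by (auto simp: parallel_def)
  then have ss: "s i \<otimes> s j \<in> H" if "i < n" "j < n" for i j
    unfolding s_def using that by (intro full_cyc2_mult[OF H S SH]) (auto simp: S_def)
  have code: "code [a @ [i], b @ [i]]" if "i < n" for i using par ab(1) that by simp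
  have s: "s i \<in> carrier G" "s i \<otimes> s i = \<one>" if "i < n" for i
    unfolding s_def using code[OF that] cyc2_square by auto
  have n0: "0 < n" using two_le by simp
  \<comment> \<open>\<open>q k\<close> swaps the first \<open>k\<close> pairs of children, so
    \<open>q n\<close> swaps \<open>a\<close> and \<open>b\<close> themselves.\<close>
  define q where "q = rec_nat \<one> (\<lambda>k g. g \<otimes> s k)"
  have q0: "q 0 = \<one>" and qS: "q (Suc k) = q k \<otimes> s k" for k by (simp_all add: q_def)
  have q: "q k \<in> carrier G" if "k \<le> n" for k
    using that by (induction k) (auto simp: q0 qS s)
  have qH: "if even k then q k \<in> H else q k \<otimes> s 0 \<in> H" if "k \<le> n" for k
    using that
  proof (induction k)
    case 0
    then show ?case using subgroup.one_closed[OF H] by (simp add: q0)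
  next
    case (Suc k)
    have c: "q k \<in> carrier G" "s k \<in> carrier G" "s 0 \<in> carrier G" using q s Suc n0 by auto
    show ?case
    proof (cases "even k")
      case True
      then have "q k \<otimes> (s k \<otimes> s 0) \<in> H" by (intro subgroup.m_closed[OF H _ ss]) (use Suc n0 in auto)
      then show ?thesis using True c by (simp add: qS m_assoc)
    next
      case False
      then have "(q k \<otimes> s 0) \<otimes> (s 0 \<otimes> s k) \<in> H" by (intro subgroup.m_closed[OF H _ ss]) (use Suc n0 in auto)
      moreover have "(q k \<otimes> s 0) \<otimes> (s 0 \<otimes> s k) = q k \<otimes> (s 0 \<otimes> s 0) \<otimes> s k" using c by (simp add: m_assoc)
      ultimately show ?thesis using False c s(2)[OF n0] by (simp add: qS)
    qed
  qed
  have qmap: "maps_cone (q k) (a @ [i]) (if i < k then b @ [i] else a @ [i]) \<and>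
      maps_cone (q k) (b @ [i]) (if i < k then a @ [i] else b @ [i])" if "i < n" "k \<le> n" for i k
    using that(2)
  proof (induction k)
    case 0
    then show ?case using ab(1) that by (simp add: q0)
  next
    case (Suc k)
    have w: "a @ [i] \<in> words" "b @ [i] \<in> words" using ab(1) that by auto
    have m: "maps_cone (s k) (a @ [i]) (if i = k then b @ [i] else a @ [i])"
      "maps_cone (s k) (b @ [i]) (if i = k then a @ [i] else b @ [i])"
      using cyc2_maps[OF code, of k] Suc.prems w par par'[of i k]
      by (auto simp: s_def intro!: cyc_parallel)
    show ?case
      using Suc m w maps_cone_mult[of "a @ [i]" "q k" _ "s k"] maps_cone_mult[of "b @ [i]" "q k" _ "s k"]
      by (auto simp: qS less_Suc_eq)
  qed
  have qout: "q k x = x" if "x \<in> C" "\<forall>u\<in>S. x \<notin> cone n u" "k \<le> n" for k x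
    using that(3)
  proof (induction k)
    case (Suc k)
    then have "s k x = x" unfolding s_def using that by (intro cyc_outside) (auto simp: S_def)
    with Suc show ?case using that(1) by (simp add: qS)
  qed (use that(1) in \<open>simp add: q0\<close>)
  have "q n = cyc [a, b]"
  proof (rule cover_ext[where U = S])
    fix u assume "u \<in> S"
    then obtain i where i: "i < n" "u = a @ [i] \<or> u = b @ [i]" by (auto simp: S_def)
    then show "\<exists>v. maps_cone (q n) u v \<and> maps_cone (cyc [a, b]) u v"
      using qmap[of i n] maps_cone_append[OF cyc2_maps(1)[OF ab(1)], of "[i]"]
        maps_cone_append[OF cyc2_maps(2)[OF ab(1)], of "[i]"] by auto
  next
    fix x assume x: "x \<in> C" "\<forall>u\<in>S. x \<notin> cone n u"
    have "x \<notin> cone n c" if c: "c = a \<or> c = b" for c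
    proof
      assume "x \<in> cone n c"
      then obtain w where w: "x = c @- w" "w \<in> C" by (elim in_coneE)
      obtain v w' where v: "w = v @- w'" "v \<in> level 1" "w' \<in> C"
        by (rule level_split[OF w(2), of 1])
      then obtain i where "v = [i]" "i < n" by (auto simp: level_def length_Suc_conv)
      then have "i < n" "x \<in> cone n (c @ [i])" using v w in_coneI[of w' "c @ [i]"] by auto
      then show False using x(2) c by (auto simp: S_def)
    qed
    then have "cyc [a, b] x = x" using x(1) by (intro cyc_outside) auto
    then show "q n x = cyc [a, b] x" using qout[OF x] by simp
  qed (use q ab in auto)
  then show ?thesis using qH[of n] by (cases "even n") (simp_all add: s_def)
qed

lemma mult_cancel_square:
  assumes H: "subgroup H G" and c: "x \<in> carrier G" "y \<in> carrier G" "z \<in> carrier G" "y \<otimes> y = \<one>"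
    and mem: "x \<otimes> y \<in> H" "y \<otimes> z \<in> H"
  shows "x \<otimes> z \<in> H"
proof -
  have "(x \<otimes> y) \<otimes> (y \<otimes> z) = x \<otimes> (y \<otimes> y) \<otimes> z" using c(1-3) by (simp add: m_assoc)
  then show ?thesis using subgroup.m_closed[OF H mem] c by simp
qed

text \<open>A permutation is sorted by 3-cycles as long as at least three words are moved. Here
  \<open>\<tau>\<close> gives preimages, so a factor on the left of \<open>f\<close> acts by
  changing them.\<close>

lemma level_perm:
  assumes H: "subgroup H G" and deep: "deep K H" "K \<le> m"
  shows "f \<in> carrier G \<Longrightarrow> (\<And>u. u \<in> level m \<Longrightarrow> \<tau> u \<in> level m \<and> maps_cone f (\<tau> u) u) \<Longrightarrow>
    f \<in> H \<or> (\<exists>a\<in>level m. \<exists>b\<in>level m. a \<noteq> b \<and> f \<otimes> cyc [a, b] \<in> H)"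
proof (induction "card {u \<in> level m. \<tau> u \<noteq> u}" arbitrary: f \<tau> rule: less_induct)
  case less
  define N where "N = {u \<in> level m. \<tau> u \<noteq> u}"
  note f = less.prems(1) and \<tau> = less.prems(2)
  have inj: "u = v" if "u \<in> level m" "v \<in> level m" "\<tau> u = \<tau> v" for u v
  proof -
    have "u @- sconst 0 = v @- sconst 0"
      using maps_coneD[OF conjunct2[OF \<tau>[OF that(1)]] zeros_in_C]
        maps_coneD[OF conjunct2[OF \<tau>[OF that(2)]] zeros_in_C] that(3) by simp
    then show ?thesis
      using not_equal_is_parallel[of u v] parallel_shift_neq[of u v] that(1,2) levelD(2) by blast
  qed
  have outside: "f x = \<one> x" if "x \<in> C" "\<forall>u\<in>level m. x \<notin> cone n u" for x :: "nat stream"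
    using level_cover[OF that(1), of m] that(2) by blast
  show ?case
  proof (cases "N = {}")
    case True
    have "f = \<one>"
    proof (rule cover_ext[where U = "level m"])
      show "\<exists>v. maps_cone f u v \<and> maps_cone \<one> u v" if "u \<in> level m" for u
        using that \<tau>[OF that] True levelD by (auto simp: N_def)
    qed (use f outside in auto)
    then show ?thesis using subgroup.one_closed[OF H] by simp
  next
    case False
    then obtain a where a: "a \<in> level m" "\<tau> a \<noteq> a" by (auto simp: N_def)
    define b where "b = \<tau> a"
    have bm: "b \<in> level m" using \<tau>[OF a(1)] by (simp add: b_def)
    then have b: "b \<in> level m" "\<tau> b \<noteq> b" "a \<noteq> b" using a inj[OF a(1) bm] by (auto simp: b_def)
    show ?thesis
    proof (cases "\<exists>c\<in>N. c \<noteq> a \<and> c \<noteq> b")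
      case True
      then obtain c where c: "c \<in> level m" "\<tau> c \<noteq> c" "c \<noteq> a" "c \<noteq> b" by (auto simp: N_def)
      \<comment> \<open>\<open>h\<close> sends \<open>a\<close> to \<open>b\<close> and
        \<open>f\<close> sends \<open>b\<close> back to \<open>a\<close>, so
        \<open>h \<otimes> f\<close> fixes \<open>a\<close>. No fixed word becomes moved, because
        \<open>a\<close>, \<open>b\<close> and \<open>c\<close> are all moved by
        \<open>f\<close>.\<close>
      define h where "h = cyc [a, b, c]"
      have code: "code [a, b, c]" using a b c by (intro antichain_code3[OF level_antichain]) auto
      have h: "h \<in> H" unfolding h_def
        using full_cyc3[OF level_antichain deep_level_full[OF deep] a(1) b(1) c(1)] b(3) c(3,4) by auto
      have hG: "h \<in> carrier G" using H h subgroup.mem_carrier by metis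
      define \<pi> where "\<pi> u = (if u = a then c else if u = b then a else if u = c then b else u)" for u
      have \<pi>: "\<pi> u \<in> level m \<and> maps_cone h (\<pi> u) u" if "u \<in> level m" for u
        using that a b c cyc3_maps[OF code] antichainD[OF level_antichain]
        by (auto simp: \<pi>_def h_def intro!: cyc_parallel)
      have f': "\<pi> (\<tau> u) \<in> level m \<and> maps_cone (h \<otimes> f) (\<pi> (\<tau> u)) u" if "u \<in> level m" for u
        using \<tau>[OF that] \<pi>[of "\<tau> u"] levelD(1) maps_cone_mult by blast
      have "\<pi> (\<tau> a) = a" using b by (simp add: \<pi>_def b_def[symmetric])
      moreover have "\<pi> (\<tau> u) = u" if "u \<in> level m" "\<tau> u = u" for u
        using that a(2) b(2) c(2) by (auto simp: \<pi>_def)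
      ultimately have "{u \<in> level m. \<pi> (\<tau> u) \<noteq> u} \<subset> {u \<in> level m. \<tau> u \<noteq> u}" using a by blast
      then have lt: "card {u \<in> level m. (\<pi> \<circ> \<tau>) u \<noteq> u} < card {u \<in> level m. \<tau> u \<noteq> u}"
        by (auto intro!: psubset_card_mono)
      have hf: "h \<otimes> f \<in> carrier G" using hG f by simp
      have cancel: "g \<in> H" if "g \<in> carrier G" "h \<otimes> g \<in> H" for g
      proof -
        have "inv h \<otimes> (h \<otimes> g) \<in> H" using H h that by (simp add: subgroup.m_closed subgroup.m_inv_closed)
        then show ?thesis using hG that by (simp flip: m_assoc)
      qed
      consider "h \<otimes> f \<in> H"
        | p q where "p \<in> level m" "q \<in> level m" "p \<noteq> q" "h \<otimes> f \<otimes> cyc [p, q] \<in> H"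
        using less.hyps[OF lt hf] f' by fastforce
      then show ?thesis
      proof cases
        case 1
        then show ?thesis using cancel f by blast
      next
        case 2
        then have pq: "cyc [p, q] \<in> carrier G" using antichainD[OF level_antichain] by simp
        have "f \<otimes> cyc [p, q] \<in> H"
          by (rule cancel[OF m_closed[OF f pq]]) (use 2(4) m_assoc[OF hG f pq] in simp)
        then show ?thesis using 2 by blast
      qed
    next
      case False
      \<comment> \<open>Injectivity shows that \<open>\<tau> b\<close> is moved too. With no third
        moved word left it must be \<open>a\<close>, and \<open>f\<close> is a
        transposition.\<close>
      have "\<tau> b \<in> level m" using \<tau>[OF b(1)] by blast
      moreover have "\<tau> (\<tau> b) \<noteq> \<tau> b" using inj[OF \<open>\<tau> b \<in> level m\<close> b(1)] b(2) by blast
      ultimately have "\<tau> b \<in> N" unfolding N_def by blast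
      then have ba: "\<tau> b = a" using False b(2) by auto
      have code: "code [a, b]" using antichainD[OF level_antichain] a b by auto
      have "f = cyc [a, b]"
      proof (rule cover_ext[where U = "level m"])
        fix u assume u: "u \<in> level m"
        consider "u = a" | "u = b" | "u \<noteq> a" "u \<noteq> b" by blast
        then show "\<exists>v. maps_cone f u v \<and> maps_cone (cyc [a, b]) u v"
        proof cases
          case 1
          then show ?thesis using \<tau>[OF b(1)] ba cyc2_maps[OF code] by auto
        next
          case 2
          then show ?thesis using \<tau>[OF a(1)] b_def cyc2_maps[OF code] by auto
        next
          case 3
          then have "\<tau> u = u" using False u by (auto simp: N_def)
          moreover have "maps_cone (cyc [a, b]) u u"
            using 3 u a b antichainD[OF level_antichain] by (intro cyc_parallel) auto
          ultimately show ?thesis using \<tau>[OF u] by auto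
        qed
      next
        fix x assume "x \<in> C" "\<forall>u\<in>level m. x \<notin> cone n u"
        then show "f x = cyc [a, b] x" using level_cover[of x m] by blast
      qed (use f code in auto)
      then have "f \<otimes> cyc [a, b] \<in> H" using cyc2_square[OF code] subgroup.one_closed[OF H] by simp
      then show ?thesis using a b by blast
    qed
  qed
qed

section \<open>Subgroups containing all 3-cycles of long words\<close>

text \<open>The words \<open>\<tau> u\<close> form a complete antichain: \<open>f\<close> sends the
  point \<open>x\<close> followed by zeros into the cone of some \<open>u\<close>, so that point
  lies in the cone of \<open>\<tau> u\<close>.\<close>

lemma comparable_image:
  assumes f: "f \<in> carrier G" and \<tau>: "\<And>u. u \<in> level m \<Longrightarrow> \<tau> u \<in> words \<and> maps_cone f (\<tau> u) u"
    and x: "x \<in> words"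
  shows "\<exists>u\<in>level m. prefix (\<tau> u) x \<or> prefix x (\<tau> u)"
proof -
  have "f (x @- sconst 0) \<in> C" using f x by simp
  then obtain u w where u: "f (x @- sconst 0) = u @- w" "u \<in> level m" "w \<in> C" by (rule level_split[where m = m])
  have "f (\<tau> u @- w) = f (x @- sconst 0)" using \<tau>[OF u(2)] u by (simp add: maps_cone_def)
  then have "\<tau> u @- w = x @- sconst 0" using carrier_inj[OF f] \<tau>[OF u(2)] u(3) x by simp
  then have "\<not> \<tau> u \<parallel> x" using parallel_shift_neq by blast
  then show ?thesis using u(2) by (auto simp: parallel_def)
qed

lemma image_parallel:
  assumes f: "f \<in> carrier G" and \<tau>: "\<And>u. u \<in> level m \<Longrightarrow> \<tau> u \<in> words \<and> maps_cone f (\<tau> u) u"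
    and "u \<in> level m" "v \<in> level m" "u \<noteq> v"
  shows "\<tau> u \<parallel> \<tau> v"
proof (rule maps_cone_parallel[OF inv_closed[OF f]])
  show "u \<parallel> v" using assms antichainD(2)[OF level_antichain] by blast
  show "maps_cone (inv f) u (\<tau> u)" "maps_cone (inv f) v (\<tau> v)"
    using \<tau> assms(3,4) maps_cone_inv[OF f] by blast+
qed (use assms levelD in auto)

text \<open>The Kraft equality of a complete prefix code with denominators cleared: the extensions
  of length \<open>M\<close> of the words \<open>\<tau> u\<close> partition
  \<open>level M\<close>.\<close>

lemma kraft:
  assumes f: "f \<in> carrier G" and \<tau>: "\<And>u. u \<in> level m \<Longrightarrow> \<tau> u \<in> words \<and> maps_cone f (\<tau> u) u"
    and M: "\<And>u. u \<in> level m \<Longrightarrow> length (\<tau> u) \<le> M"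
  shows "(\<Sum>u\<in>level m. n ^ (M - length (\<tau> u))) = n ^ M"
proof -
  define E where "E u = (\<lambda>s. \<tau> u @ s) ` level (M - length (\<tau> u))" for u
  have E: "(\<Union>u\<in>level m. E u) = level M"
  proof (intro equalityI subsetI)
    fix x assume x: "x \<in> level M"
    then obtain u where u: "u \<in> level m" "prefix (\<tau> u) x \<or> prefix x (\<tau> u)"
      using comparable_image[OF f \<tau>, where x = x] levelD by blast
    have "prefix (\<tau> u) x"
      using u(2) M[OF u(1)] levelD(2)[OF x] by (metis prefix_length_le prefix_length_prefix prefix_order.refl)
    then obtain s where "x = \<tau> u @ s" by (auto elim: prefixE)
    then have "x \<in> E u" using x by (auto simp: E_def level_def)
    then show "x \<in> (\<Union>u\<in>level m. E u)" using u(1) by blast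
  qed (use \<tau> M in \<open>auto simp: E_def level_def\<close>)
  have disj: "E u \<inter> E v = {}" if "u \<in> level m" "v \<in> level m" "u \<noteq> v" for u v
  proof -
    have "\<tau> u \<parallel> \<tau> v" using f \<tau> that by (rule image_parallel)
    then have "\<tau> u @ s \<noteq> \<tau> v @ s'" for s s'
      using parallel_append[of "\<tau> u" "\<tau> v" s s'] by (auto simp: parallel_def)
    then show ?thesis by (auto simp: E_def)
  qed
  have "card (E u) = n ^ (M - length (\<tau> u))" for u
    unfolding E_def by (subst card_image) (auto simp: card_level inj_on_def)
  moreover have "card (\<Union>u\<in>level m. E u) = (\<Sum>u\<in>level m. card (E u))"
    using disj by (intro card_UN_disjoint) (auto simp: E_def)
  ultimately show ?thesis by (simp add: E card_level)
qed

text \<open>There are \<open>n ^ m\<close> words \<open>\<tau> u\<close>, so the Kraft equality also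
  holds with every length replaced by \<open>m\<close>. A deviation to one side must be compensated
  on the other.\<close>

lemma ex_short_and_long:
  assumes f: "f \<in> carrier G" and \<tau>: "\<And>u. u \<in> level m \<Longrightarrow> \<tau> u \<in> words \<and> maps_cone f (\<tau> u) u"
    and ne: "\<exists>u\<in>level m. length (\<tau> u) \<noteq> m"
  shows "\<exists>u\<in>level m. length (\<tau> u) < m" "\<exists>u\<in>level m. m < length (\<tau> u)"
proof -
  have n: "1 < n" using two_le by simp
  define M where "M = Max (insert m ((\<lambda>u. length (\<tau> u)) ` level m))"
  have M: "length (\<tau> u) \<le> M" if "u \<in> level m" for u using that by (simp add: M_def)
  have mM: "m \<le> M" by (simp add: M_def)
  have sum: "(\<Sum>u\<in>level m. n ^ (M - length (\<tau> u))) = (\<Sum>u\<in>level m. n ^ (M - m))"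
    using kraft[OF f \<tau> M] mM by (simp add: card_level flip: power_add)
  show "\<exists>u\<in>level m. length (\<tau> u) < m"
  proof (rule ccontr)
    assume no: "\<not> (\<exists>u\<in>level m. length (\<tau> u) < m)"
    have "(\<Sum>u\<in>level m. n ^ (M - length (\<tau> u))) < (\<Sum>u\<in>level m. n ^ (M - m))"
    proof (rule sum_strict_mono_ex1)
      show "\<forall>u\<in>level m. n ^ (M - length (\<tau> u)) \<le> n ^ (M - m)" using n no by (auto intro!: power_increasing)
      obtain u where "u \<in> level m" "m < length (\<tau> u)" using ne no by (meson nat_neq_iff)
      then show "\<exists>u\<in>level m. n ^ (M - length (\<tau> u)) < n ^ (M - m)"
        using n M by (intro bexI[of _ u] power_strict_increasing) (auto simp: diff_less_mono2 order_less_le_trans)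
    qed simp
    with sum show False by simp
  qed
  show "\<exists>u\<in>level m. m < length (\<tau> u)"
  proof (rule ccontr)
    assume no: "\<not> (\<exists>u\<in>level m. m < length (\<tau> u))"
    have "(\<Sum>u\<in>level m. n ^ (M - m)) < (\<Sum>u\<in>level m. n ^ (M - length (\<tau> u)))"
    proof (rule sum_strict_mono_ex1)
      show "\<forall>u\<in>level m. n ^ (M - m) \<le> n ^ (M - length (\<tau> u))" using n no by (auto intro!: power_increasing)
      obtain u where "u \<in> level m" "length (\<tau> u) < m" using ne no by (meson nat_neq_iff)
      then show "\<exists>u\<in>level m. n ^ (M - m) < n ^ (M - length (\<tau> u))"
        using n mM by (intro bexI[of _ u] power_strict_increasing) (auto simp: diff_less_mono2 order_less_le_trans)
    qed simp
    with sum show False by simp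
  qed
qed

text \<open>While the words \<open>\<tau> u\<close> do not all have length \<open>m\<close>, some word \<open>w\<close> of length at least \<open>m\<close> has
  all its children among them, and some \<open>v\<close> among them is shorter than \<open>m\<close>.  A 3-cycle through
  \<open>w\<close> and \<open>v\<close> moves the children of \<open>w\<close> below \<open>v\<close>, which decreases the total length.\<close>

lemma uniformize:
  assumes H: "subgroup H G" and deep: "deep K H" "K \<le> m" and m3: "3 \<le> m"
  shows "f \<in> carrier G \<Longrightarrow>
    (\<And>u. u \<in> level m \<Longrightarrow> \<tau> u \<in> words \<and> K \<le> length (\<tau> u) \<and> maps_cone f (\<tau> u) u) \<Longrightarrow>
    \<exists>h\<in>H. \<exists>\<pi>. \<forall>u\<in>level m. \<pi> u \<in> level m \<and> maps_cone (h \<otimes> f) (\<pi> u) u"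
proof (induction "\<Sum>u\<in>level m. length (\<tau> u)" arbitrary: f \<tau> rule: less_induct)
  case less
  note f = less.prems(1)
  have \<tau>: "\<tau> u \<in> words \<and> maps_cone f (\<tau> u) u" and \<tau>K: "K \<le> length (\<tau> u)" if "u \<in> level m" for u
    using less.prems(2)[OF that] by auto
  have par: "\<tau> u \<parallel> \<tau> v" if "u \<in> level m" "v \<in> level m" "u \<noteq> v" for u v
    using f \<tau> that by (rule image_parallel)
  show ?case
  proof (cases "\<exists>u\<in>level m. length (\<tau> u) \<noteq> m")
    case False
    then have "\<forall>u\<in>level m. \<tau> u \<in> level m \<and> maps_cone (\<one> \<otimes> f) (\<tau> u) u"
      using \<tau> f by (auto simp: level_def)
    then show ?thesis using subgroup.one_closed[OF H] by blast
  next
    case True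
    then obtain a where a: "a \<in> level m" "length (\<tau> a) < m" using ex_short_and_long(1)[OF f \<tau>] by blast
    define M where "M = Max ((\<lambda>u. length (\<tau> u)) ` level m)"
    have fin: "finite ((\<lambda>u. length (\<tau> u)) ` level m)" "(\<lambda>u. length (\<tau> u)) ` level m \<noteq> {}" using a by auto
    have M: "length (\<tau> u) \<le> M" if "u \<in> level m" for u using that by (simp add: M_def)
    obtain d where d: "d \<in> level m" "length (\<tau> d) = M" using Max_in[OF fin] by (auto simp: M_def)
    have mM: "m < M" using ex_short_and_long(2)[OF f \<tau> True] M by (auto intro: order_less_le_trans)
    then have "\<tau> d \<noteq> []" using d by auto
    \<comment> \<open>The parent of a longest \<open>\<tau> d\<close>. Each child of
      \<open>w\<close> is comparable to some \<open>\<tau> u\<close>, which is not longer than the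
      child and is no prefix of \<open>w\<close>, hence equals the child.\<close>
    then obtain w i0 where w: "\<tau> d = w @ [i0]" by (metis append_butlast_last_id)
    have ww: "w \<in> words" "length w + 1 = M" "i0 < n" using w \<tau>[OF d(1)] d(2) by auto
    have no_prefix: "\<not> prefix (\<tau> u) w" if u: "u \<in> level m" for u
    proof
      assume pre: "prefix (\<tau> u) w"
      then have "prefix (\<tau> u) (\<tau> d)" by (simp add: w)
      then have "u = d" using par[OF u d(1)] by (auto simp: parallel_def)
      then show False using pre d(2) ww(2) prefix_length_le by fastforce
    qed
    have "\<exists>u\<in>level m. \<tau> u = w @ [j]" if "j < n" for j
    proof -
      have "w @ [j] \<in> words" using ww(1) that by simp
      then have "\<exists>u\<in>level m. prefix (\<tau> u) (w @ [j]) \<or> prefix (w @ [j]) (\<tau> u)"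
        using f \<tau> by (intro comparable_image[of f m \<tau>]) auto
      then obtain u where u: "u \<in> level m" "prefix (\<tau> u) (w @ [j]) \<or> prefix (w @ [j]) (\<tau> u)"
        by blast
      have "length (\<tau> u) \<le> length (w @ [j])" using M[OF u(1)] ww(2) by simp
      then have "prefix (\<tau> u) (w @ [j])" using u(2) by (metis prefix_length_prefix prefix_order.refl)
      then show ?thesis using no_prefix[OF u(1)] u(1) by (auto simp: prefix_snoc)
    qed
    then obtain c where c: "\<And>j. j < n \<Longrightarrow> c j \<in> level m \<and> \<tau> (c j) = w @ [j]" by metis
    define B where "B = c ` {..<n}"
    have Bm: "B \<subseteq> level m" using c by (auto simp: B_def)
    have "inj_on c {..<n}"
    proof (rule inj_onI)
      fix i j assume ij: "i \<in> {..<n}" "j \<in> {..<n}" and eq: "c i = c j"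
      have "w @ [i] = \<tau> (c i)" using c ij(1) by simp
      also have "\<dots> = w @ [j]" unfolding eq using c ij(2) by simp
      finally show "i = j" by simp
    qed
    then have cardB: "card B = n" by (simp add: B_def card_image)
    have parw: "\<tau> u \<parallel> w" if u: "u \<in> level m" "u \<notin> B" for u
    proof
      show "\<not> prefix (\<tau> u) w" by (rule no_prefix[OF u(1)])
      show "\<not> prefix w (\<tau> u)"
      proof
        assume "prefix w (\<tau> u)"
        then obtain s where s: "\<tau> u = w @ s" by (auto elim: prefixE)
        have "s \<noteq> []" using s no_prefix[OF u(1)] by auto
        moreover have "length s \<le> 1" using M[OF u(1)] s ww(2) by simp
        ultimately obtain j where j: "s = [j]" by (cases s) auto
        then have "j < n" using \<tau>[OF u(1)] s by simp
        then have "\<tau> (c j) = \<tau> u" "c j \<in> level m" "c j \<noteq> u" using c s j u(2) by (auto simp: B_def)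
        then show False using par[of "c j" u] u(1) by (auto simp: parallel_def)
      qed
    qed
    have lenB: "length (\<tau> u) = M" if "u \<in> B" for u using that c ww(2) by (auto simp: B_def)
    have aB: "a \<notin> B" using lenB a(2) mM by fastforce
    \<comment> \<open>A 3-cycle requires a third word besides \<open>v\<close> and \<open>w\<close>.
      The count \<open>n + 1 < n ^ 3\<close> with \<open>3 \<le> m\<close> leaves a word
      \<open>b\<close> outside \<open>B\<close> and different from \<open>a\<close>.\<close>
    have "card (insert a B) \<le> n + 1" using cardB Bm finite_subset[OF Bm] by (simp add: card_insert_if)
    moreover have "n + 1 < n ^ 3"
    proof -
      have "n * (2 * 2) \<le> n * (n * n)" by (intro mult_le_mono2 mult_le_mono two_le)
      then show ?thesis using two_le unfolding power3_eq_cube mult.assoc by linarith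
    qed
    moreover have "n ^ 3 \<le> card (level m)" using two_le m3 by (simp add: card_level power_increasing)
    ultimately have "\<not> level m \<subseteq> insert a B"
      using card_mono[of "insert a B" "level m"] finite_subset[OF Bm] by auto
    then obtain b where b: "b \<in> level m" "b \<noteq> a" "b \<notin> B" by blast
    define v where "v = \<tau> a"
    define z where "z = \<tau> b"
    have code: "code [z, v, w]"
      using par[OF b(1) a(1) b(2)] parw[OF a(1) aB] parw[OF b(1,3)] \<tau>[OF a(1)] \<tau>[OF b(1)] ww(1)
      by (simp add: v_def z_def)
    define h where "h = cyc [z, v, w]"
    have wK: "K \<le> length w" using mM ww(2) deep(2) by simp
    have h: "h \<in> H" using deep(1) code \<tau>K[OF a(1)] \<tau>K[OF b(1)] wK by (auto simp: h_def v_def z_def deep_def)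
    have hG: "h \<in> carrier G" using H h subgroup.mem_carrier by metis
    \<comment> \<open>The preimage of \<open>\<tau> u\<close> under \<open>h\<close>, which sends
      \<open>z\<close> to \<open>v\<close>, \<open>v\<close> to \<open>w\<close> and
      \<open>w\<close> to \<open>z\<close>.\<close>
    define \<tau>' where "\<tau>' u = (if u = a then z else if u = b then w else
      if u \<in> B then v @ [last (\<tau> u)] else \<tau> u)" for u
    have \<tau>': "\<tau>' u \<in> words \<and> K \<le> length (\<tau>' u) \<and> maps_cone h (\<tau>' u) (\<tau> u)" if u: "u \<in> level m" for u
    proof -
      consider "u = a" | "u = b" | j where "j < n" "u = c j" "u \<in> B" | "u \<noteq> a" "u \<noteq> b" "u \<notin> B"
        by (auto simp: B_def)
      then show ?thesis
      proof cases
        case 1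
        then show ?thesis using cyc3_maps(1)[OF code] \<tau>[OF b(1)] \<tau>K[OF b(1)]
          by (simp add: \<tau>'_def h_def v_def z_def)
      next
        case 2
        then show ?thesis using cyc3_maps(3)[OF code] ww(1) wK b(2)
          by (simp add: \<tau>'_def h_def z_def)
      next
        case 3
        then have "\<tau>' u = v @ [j]" "\<tau> u = w @ [j]" using c aB b(3) by (auto simp: \<tau>'_def)
        then show ?thesis
          using maps_cone_append[OF cyc3_maps(2)[OF code], of "[j]"] 3(1) \<tau>[OF a(1)] \<tau>K[OF a(1)]
          by (simp add: h_def v_def)
      next
        case 4
        then have "maps_cone h (\<tau> u) (\<tau> u)"
          using par[OF u a(1)] par[OF u b(1)] parw[OF u] \<tau>[OF u]
          by (auto simp: h_def v_def z_def intro!: cyc_parallel)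
        then show ?thesis using 4 \<tau>[OF u] \<tau>K[OF u] by (simp add: \<tau>'_def)
      qed
    qed
    have maps: "\<tau>' u \<in> words \<and> K \<le> length (\<tau>' u) \<and> maps_cone (h \<otimes> f) (\<tau>' u) u" if "u \<in> level m" for u
      using \<tau>'[OF that] \<tau>[OF that] maps_cone_mult by blast
    define R where "R = level m - insert a (insert b B)"
    have split: "(\<Sum>u\<in>level m. g u) = g a + g b + sum g B + sum g R" for g :: "nat list \<Rightarrow> nat"
    proof -
      have "level m = insert a (insert b (B \<union> R))" using a b Bm by (auto simp: R_def)
      moreover have "finite B" "finite R" using finite_subset[OF Bm] by (auto simp: R_def)
      moreover have "B \<inter> R = {}" "a \<notin> insert b (B \<union> R)" "b \<notin> B \<union> R" using a b aB by (auto simp: R_def)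
      ultimately show ?thesis by (simp add: sum.union_disjoint add.assoc)
    qed
    have R: "(\<Sum>u\<in>R. length (\<tau>' u)) = (\<Sum>u\<in>R. length (\<tau> u))"
      by (rule sum.cong) (auto simp: R_def \<tau>'_def)
    have "(\<Sum>u\<in>B. length (\<tau>' u)) = (\<Sum>u\<in>B. length v + 1)"
      using aB b(3) by (intro sum.cong) (auto simp: \<tau>'_def)
    moreover have "(\<Sum>u\<in>B. length (\<tau> u)) = (\<Sum>u\<in>B. M)" using lenB by (intro sum.cong) auto
    ultimately have B: "(\<Sum>u\<in>B. length (\<tau>' u)) = n * (length v + 1)" "(\<Sum>u\<in>B. length (\<tau> u)) = n * M"
      using cardB by simp_all
    have vw: "length v < length w" using a(2) mM ww(2) by (simp add: v_def)
    \<comment> \<open>The two sides differ by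
      \<open>(n - 1) * (length w - length v)\<close>.\<close>
    have "length w + n * (length v + 1) < length v + n * M"
    proof -
      obtain k where k: "length w = length v + Suc k" using vw less_imp_Suc_add by auto
      obtain l where "n = 2 + l" using two_le le_Suc_ex by blast
      moreover have "M = length v + k + 2" using k ww(2) by simp
      ultimately show ?thesis using k by (simp add: algebra_simps)
    qed
    then have "(\<Sum>u\<in>level m. length (\<tau>' u)) < (\<Sum>u\<in>level m. length (\<tau> u))"
      unfolding split R B using b(2) by (simp add: \<tau>'_def v_def z_def)
    from less.hyps[OF this _ maps] hG f
    obtain k \<pi> where k: "k \<in> H" and \<pi>: "\<forall>u\<in>level m. \<pi> u \<in> level m \<and> maps_cone (k \<otimes> (h \<otimes> f)) (\<pi> u) u" by auto
    have kG: "k \<in> carrier G" using H k subgroup.mem_carrier by metis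
    have "k \<otimes> h \<in> H" using k h subgroup.m_closed[OF H] by blast
    moreover have "k \<otimes> (h \<otimes> f) = k \<otimes> h \<otimes> f" using kG hG f by (simp add: m_assoc)
    ultimately show ?thesis using \<pi> by auto
  qed
qed

text \<open>Multiplication by elements of \<open>H\<close> turns \<open>f\<close> into a permutation
  of a level and then leaves at most one transposition there. That transposition is exchanged for
  \<open>t j\<close>, which swaps the descendants of \<open>p\<close> and \<open>q\<close> by
  \<open>j\<close> zeros. By \<open>cyc2_parity\<close>, \<open>t j\<close> lies in \<open>H\<close>
  or is linked to \<open>t 0\<close>, the swap of \<open>p\<close> and \<open>q\<close>.\<close>

lemma deep_index_two:
  assumes H: "subgroup H G" and deep: "deep K H"
    and pq: "code [p, q]" "K \<le> length p" "length p = length q"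
    and f: "f \<in> carrier G"
  shows "f \<in> H \<or> f \<otimes> cyc [p, q] \<in> H"
proof -
  obtain m0 where m0: "\<And>u. u \<in> level m0 \<Longrightarrow> \<exists>v\<in>words. maps_cone (inv f) u v"
    using inv_closed[OF f] unfolding carrier_eq by blast
  \<comment> \<open>\<open>m0\<close> pays for the letters lost under \<open>inv f\<close>,
    \<open>K\<close> keeps the preimages long, and 3 serves \<open>uniformize\<close>. Adding
    \<open>length p\<close> makes the descendants of \<open>p\<close> and \<open>q\<close> by
    \<open>j\<close> zeros words of length \<open>m\<close>.\<close>
  define j where "j = m0 + K + 3"
  define m where "m = length p + j"
  have "\<exists>v. v \<in> words \<and> K \<le> length v \<and> maps_cone f v u" if "u \<in> level m" for u
  proof -
    have "m0 \<le> length u" "u \<in> words" using that by (auto simp: level_def m_def j_def)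
    then obtain v where v: "v \<in> words" "maps_cone (inv f) u v" "length u \<le> length v + m0"
      using maps_cone_refine[OF m0, where u = u] by blast
    then have "maps_cone f v u" using maps_cone_inv[OF inv_closed[OF f] \<open>u \<in> words\<close>] f by simp
    then show ?thesis using v levelD(2)[OF that] by (auto simp: m_def j_def)
  qed
  then obtain \<tau> where \<tau>: "\<And>u. u \<in> level m \<Longrightarrow> \<tau> u \<in> words \<and> K \<le> length (\<tau> u) \<and> maps_cone f (\<tau> u) u"
    by metis
  have Km: "K \<le> m" "3 \<le> m" by (auto simp: m_def j_def)
  obtain h \<pi> where h: "h \<in> H" and \<pi>: "\<And>u. u \<in> level m \<Longrightarrow> \<pi> u \<in> level m \<and> maps_cone (h \<otimes> f) (\<pi> u) u"
    using uniformize[OF H deep Km f \<tau>] by metis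
  have hG: "h \<in> carrier G" using H h subgroup.mem_carrier by metis
  have cancel: "g \<in> H" if "g \<in> carrier G" "h \<otimes> g \<in> H" for g
  proof -
    have "inv h \<otimes> (h \<otimes> g) \<in> H" using H h that by (simp add: subgroup.m_closed subgroup.m_inv_closed)
    then show ?thesis using hG that by (simp flip: m_assoc)
  qed
  define t where "t i = cyc [p @ replicate i 0, q @ replicate i 0]" for i
  have n0: "replicate i 0 \<in> words" for i using two_le by (induction i) auto
  have tcode: "code [p @ replicate i 0, q @ replicate i 0]" for i
    using pq(1) n0 parallel_append by auto
  have tG: "t i \<in> carrier G" "t i \<otimes> t i = \<one>" for i
    unfolding t_def using tcode cyc2_square by auto
  have parity: "if even n then t i \<in> H else t i \<otimes> t (Suc i) \<in> H" for i
    using cyc2_parity[OF H deep tcode[of i]] pq(2,3)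
    by (cases "even n") (simp_all add: t_def replicate_append_same)
  have tj: "t i \<in> H \<or> t i \<otimes> t 0 \<in> H" for i
  proof (cases "even n")
    case False
    have "t i \<otimes> t 0 \<in> H" for i
    proof (induction i)
      case 0
      then show ?case using subgroup.one_closed[OF H] by (simp add: tG)
    next
      case (Suc i)
      have "inv (t i \<otimes> t (Suc i)) \<in> H" using parity[of i] False H by (simp add: subgroup.m_inv_closed)
      moreover have "inv (t k) = t k" for k using tG inv_equality by blast
      ultimately have "t (Suc i) \<otimes> t i \<in> H" by (simp add: inv_mult_group tG)
      then show ?case using mult_cancel_square[OF H tG(1) tG(1) tG(1) tG(2)] Suc by blast
    qed
    then show ?thesis by blast
  qed (use parity in simp)
  consider "h \<otimes> f \<in> H" | a b where "a \<in> level m" "b \<in> level m" "a \<noteq> b" "h \<otimes> f \<otimes> cyc [a, b] \<in> H"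
    using level_perm[OF H deep Km(1) m_closed[OF hG f] \<pi>] by blast
  then show ?thesis
  proof cases
    case 1
    then show ?thesis using cancel f by blast
  next
    case 2
    have code: "code [a, b]" using antichainD[OF level_antichain] 2 by auto
    define s where "s = cyc [a, b]"
    have s: "s \<in> carrier G" "s \<otimes> s = \<one>" using code cyc2_square by (auto simp: s_def)
    have "h \<otimes> (f \<otimes> s) \<in> H" using 2(4) m_assoc[OF hG f s(1)] by (simp add: s_def)
    then have fs: "f \<otimes> s \<in> H" by (rule cancel[OF m_closed[OF f s(1)]])
    have "p @ replicate j 0 \<in> level m" "q @ replicate j 0 \<in> level m"
      using tcode[of j] pq(3) by (auto simp: level_def m_def)
    moreover have "p @ replicate j 0 \<noteq> q @ replicate j 0" using tcode[of j] by auto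
    ultimately have "s \<otimes> t j \<in> H"
      unfolding s_def t_def using 2 by (intro full_cyc2_mult[OF H level_antichain deep_level_full[OF deep Km(1)]])
    then have ft: "f \<otimes> t j \<in> H" using mult_cancel_square[OF H f s(1) tG(1) s(2) fs] by blast
    from tj[of j] show ?thesis
    proof
      assume t: "t j \<in> H"
      have "f \<otimes> t j \<otimes> t j \<in> H" by (rule subgroup.m_closed[OF H ft t])
      then show ?thesis using f tG by (simp add: m_assoc)
    next
      assume "t j \<otimes> t 0 \<in> H"
      then have "f \<otimes> t 0 \<in> H" using mult_cancel_square[OF H f tG(1) tG(1) tG(2) ft] by blast
      then show ?thesis by (simp add: t_def)
    qed
  qed
qed

section \<open>The derived subgroup\<close>

text \<open>A 3-cycle \<open>s\<close> is a product of two transpositions, whose commutator is the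
  square of \<open>s\<close>; and \<open>s\<close> is the inverse of its square.\<close>

lemma cyc3_derived:
  assumes "code [a, b, c]"
  shows "cyc [a, b, c] \<in> derived G (carrier G)"
proof -
  define D where "D = derived G (carrier G)"
  have D: "subgroup D G" unfolding D_def by (rule derived_is_subgroup) simp
  have code: "code [a, c, b]" "code [a, c]" "code [c, b]" using assms parallel_commute[of b c] by auto
  define s where "s = cyc [a, b, c]"
  define x where "x = cyc [a, c]"
  define y where "y = cyc [c, b]"
  have c: "s \<in> carrier G" "x \<in> carrier G" "y \<in> carrier G" using assms code by (simp_all add: s_def x_def y_def)
  have xy: "x \<otimes> y = s" unfolding s_def x_def y_def by (rule cyc2_mult[OF code(1)])
  have "inv x = x" "inv y = y"
    using code(2,3) cyc2_square inv_equality by (simp_all add: x_def y_def)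
  moreover have "x \<otimes> y \<otimes> inv x \<otimes> inv y \<in> D"
    unfolding D_def derived_def using c by (intro generate.incl) blast
  ultimately have "s \<otimes> x \<otimes> y \<in> D" using xy by simp
  then have "s \<otimes> s \<in> D" using c xy by (simp add: m_assoc)
  then have "inv (s \<otimes> s) \<in> D" using D by (simp add: subgroup.m_inv_closed)
  moreover have "s \<otimes> (s \<otimes> s) = \<one>"
    using cyc_pow_length[OF assms] c by (simp add: s_def numeral_3_eq_3 m_assoc)
  then have "inv (s \<otimes> s) = s" using c by (intro inv_equality) auto
  ultimately show ?thesis by (simp add: s_def D_def)
qed

text \<open>The derived subgroup contains all 3-cycles, so \<open>deep_index_two\<close> with
  threshold 0 bounds its index by two, and squares have trivial sign.\<close>

lemma square_derived:
  assumes "f \<in> carrier G"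
  shows "f \<otimes> f \<in> derived G (carrier G)"
proof -
  have D: "subgroup (derived G (carrier G)) G" by (rule derived_is_subgroup) simp
  have deep: "deep 0 (derived G (carrier G))" by (simp add: deep_def cyc3_derived del: code3)
  have pq: "code [[0], [1]]" using two_le by (auto intro: not_equal_is_parallel)
  show ?thesis
    using index_two_mult[OF D cyc_carrier[OF pq] deep_index_two[OF D deep pq] assms assms] by simp
qed

text \<open>For \<open>k = 2 * j + 1\<close> the element \<open>f\<close> is the power
  \<open>j + 1\<close> of its square.\<close>

lemma odd_order_derived:
  assumes f: "f \<in> carrier G" and k: "f [^] (k :: nat) = \<one>" "odd k"
  shows "f \<in> derived G (carrier G)"
proof -
  define D where "D = derived G (carrier G)"
  have D: "subgroup D G" unfolding D_def by (rule derived_is_subgroup) simp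
  have pow: "x [^] k \<in> D" if "x \<in> D" for x and k :: nat
    using that D by (induction k) (simp_all add: subgroup.m_closed subgroup.one_closed)
  obtain j where j: "k = 2 * j + 1" using k(2) by (elim oddE)
  have "(f \<otimes> f) [^] Suc j \<in> D" using square_derived[OF f] pow unfolding D_def by blast
  moreover have "(f \<otimes> f) [^] Suc j = f [^] k \<otimes> f"
  proof -
    have "f \<otimes> f = f [^] (2 :: nat)" using f by (simp add: numeral_2_eq_2)
    then have "(f \<otimes> f) [^] Suc j = f [^] (2 * Suc j)" using f by (simp only: nat_pow_pow)
    also have "2 * Suc j = Suc k" using j by simp
    finally show ?thesis by simp
  qed
  ultimately show ?thesis using f k(1) by (simp add: D_def)
qed

section \<open>The second generator\<close>

text \<open>A moved point and its image differ at some coordinate \<open>i\<close>. A prefix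
  \<open>u\<close> is chosen so long that \<open>u\<close> and its image \<open>v\<close> both
  contain that coordinate, which makes them incomparable.\<close>

lemma ex_moved_cone:
  assumes g: "g \<in> carrier G" "g \<noteq> \<one>"
  shows "\<exists>u\<in>words. \<exists>v\<in>words. u \<parallel> v \<and> maps_cone g u v"
proof -
  obtain x where x: "x \<in> C" "g x \<noteq> x" using carrier_ext[OF g(1) one_closed] g(2) by fastforce
  then have "\<not> (\<forall>i. g x !! i = x !! i)" using smap_alt[of id "g x" x] by (simp add: stream.map_id)
  then obtain i where i: "g x !! i \<noteq> x !! i" by blast
  obtain m where m: "\<And>u. u \<in> level m \<Longrightarrow> \<exists>v\<in>words. maps_cone g u v"
    using g(1) by (auto simp: carrier_eq)
  \<comment> \<open>At least \<open>m\<close> letters let \<open>g\<close> act by a replacement, and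
    at most \<open>m\<close> letters are lost; more than \<open>i\<close> remain.\<close>
  define k where "k = Suc (m + i + m)"
  obtain u w where u: "x = u @- w" "u \<in> level k" "w \<in> C" by (rule level_split[OF x(1)])
  have "m \<le> length u" "u \<in> words" using levelD[OF u(2)] by (auto simp: k_def)
  then obtain v where v: "v \<in> words" "maps_cone g u v" "length u \<le> length v + m"
    using maps_cone_refine[OF m] by blast
  have len: "i < length u" "i < length v" using v(3) levelD(2)[OF u(2)] by (auto simp: k_def)
  have "g x = v @- w" using v(2) u by (simp add: maps_cone_def)
  then have "u ! i \<noteq> v ! i" using i len u(1) by simp
  then have "u \<parallel> v" using len by (auto simp: parallel_def prefix_def nth_append)
  then show ?thesis using u(2) v levelD(1) by blast
qed

text \<open>Conjugation by the cycle fixes \<open>x\<close> and \<open>y\<close> and advances the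
  third word by one place.\<close>

lemma cyc_orbit:
  assumes H: "subgroup H G" and xs: "code xs" "cyc xs \<in> H"
    and xy: "x \<in> words" "y \<in> words" "x \<parallel> y" "\<And>z. z \<in> set xs \<Longrightarrow> x \<parallel> z \<and> y \<parallel> z"
    and start: "cyc [x, y, xs ! 0] \<in> H"
  shows "i < length xs \<Longrightarrow> cyc [x, y, xs ! i] \<in> H"
proof (induction i)
  case (Suc i)
  then have code: "code [x, y, xs ! i]" using xy code_nth[OF xs(1)] by auto
  have "maps_cone (cyc xs) (xs ! i) (xs ! Suc i)" using cyc_nth[OF xs(1), of i] Suc.prems by simp
  moreover have "maps_cone (cyc xs) x x" "maps_cone (cyc xs) y y" using xy by (auto intro!: cyc_parallel)
  ultimately show ?case using cyc3_conj_mem[OF H xs(2) _ code] Suc by simp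
qed (use start in simp)

lemma cyc_orbit_mem:
  assumes "subgroup H G" "code (z # zs)" "cyc (z # zs) \<in> H"
    and "x \<in> words" "y \<in> words" "x \<parallel> y" "\<And>z'. z' \<in> set (z # zs) \<Longrightarrow> x \<parallel> z' \<and> y \<parallel> z'"
    and "cyc [x, y, z] \<in> H" "z' \<in> set (z # zs)"
  shows "cyc [x, y, z'] \<in> H"
  using cyc_orbit[OF assms(1-6), of] assms(7-9) by (metis in_set_conv_nth nth_Cons_0)

text \<open>Locates the support of a cycle: cycles located in disjoint parts of one antichain
  commute.\<close>

definition extends :: "nat list set \<Rightarrow> nat list list \<Rightarrow> bool" where
  "extends P xs \<longleftrightarrow> (\<forall>x\<in>set xs. \<exists>p\<in>P. prefix p x)"

lemma extends_commute:
  assumes "antichain X" "P \<union> Q \<subseteq> X" "P \<inter> Q = {}" "extends P xs" "extends Q ys" "code xs" "code ys"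
  shows "cyc xs \<otimes> cyc ys = cyc ys \<otimes> cyc xs"
proof (rule cyc_commute[OF assms(6,7)])
  fix x y assume "x \<in> set xs" "y \<in> set ys"
  then obtain p q s t where pq: "p \<in> P" "q \<in> Q" "x = p @ s" "y = q @ t"
    using assms(4,5) unfolding extends_def prefix_def by metis
  then have "p \<parallel> q" using antichainD(2)[OF assms(1)] assms(2,3) by blast
  then show "x \<parallel> y" using pq parallel_append by simp
qed

text \<open>A length that is 1 modulo 30 is coprime to 2, 3 and 5. The bound
  \<open>2 \<le> e\<close> secures two shared words for gluing. In the witness, 29 acts as -1 modulo
  30.\<close>

lemma ex_residue_one: "\<exists>e. 2 \<le> e \<and> e < 32 \<and> (c + e) mod 30 = (1 :: nat)"
proof (intro exI conjI)
  have "(c + (2 + 29 * (c + 1) mod 30)) mod 30 = (c + 2 + 29 * (c + 1)) mod 30"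
    by (metis add.assoc mod_add_right_eq)
  also have "c + 2 + 29 * (c + 1) = 1 + (c + 1) * 30" by simp
  finally show "(c + (2 + 29 * (c + 1) mod 30)) mod 30 = 1" by simp
qed auto

text \<open>\<open>extra\<close> selects the target: the whole group, with a transposition among the
  factors of \<open>h\<close>, or the derived subgroup, with factors of odd order only. The
  threshold \<open>K\<close> is chosen before \<open>H\<close>.\<close>

lemma generation:
  assumes g: "g \<in> carrier G" "g \<noteq> \<one>"
  shows "\<exists>h\<in>carrier G. \<exists>K. (\<forall>H. subgroup H G \<longrightarrow> g \<in> H \<longrightarrow> h \<in> H \<longrightarrow> deep K H \<and>
      (extra \<longrightarrow> (\<exists>p q. code [p, q] \<and> K \<le> length p \<and> length p = length q \<and> cyc [p, q] \<in> H))) \<and>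
    (\<not> extra \<longrightarrow> h \<in> derived G (carrier G))"
proof -
  obtain u v where u: "u \<in> words" and v: "v \<in> words" and uv: "u \<parallel> v" and guv: "maps_cone g u v"
    using ex_moved_cone[OF g] by blast
  have vu: "v \<parallel> u" using uv parallel_commute by blast
  \<comment> \<open>A power of 5 is coprime to 2 and 3; the exponent makes it exceed
    \<open>n\<close>, so that a cycle of this length has room for \<open>n\<close> children.\<close>
  define k where "k = (5 :: nat) ^ n"
  have k: "n < k" unfolding k_def by (rule less_exp[THEN order_less_le_trans]) (simp add: power_mono)
  define m where "m = k + 50"
  define L where "L = level m"
  have L: "finite L" "antichain L" "L \<subseteq> words" and cL: "k + 50 < card L"
  proof -
    have "m < 2 ^ m" by (rule less_exp)
    also have "2 ^ m \<le> n ^ m" using two_le by (rule power_mono) simp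
    finally show "k + 50 < card L" by (simp add: L_def card_level m_def)
  qed (auto simp: L_def level_antichain levelD)
  \<comment> \<open>Roles of the indices of \<open>w\<close>: 0 to 2 for the 3-cycle, 3 for the leaf
    to be expanded, 4 and 5 for the transposition, 6 up to \<open>g0 - 1\<close> to fill the cycle
    through the children, and the next \<open>e\<close> for the words below \<open>u\<close> on the
    long cycle. The surplus of 50 accommodates them, as \<open>e < 32\<close>.\<close>
  obtain w where "bij_betw w {0..<card L} L" using ex_bij_betw_nat_finite[OF L(1)] by blast
  then have w_inj: "inj_on w {0..<card L}" and w_img: "w ` {0..<card L} = L" by (auto simp: bij_betw_def)
  have w: "w i \<in> L" "w i \<in> words" if "i < k + 50" for i
    using that cL w_img L(3) by auto
  have w_eq: "w i = w j \<longleftrightarrow> i = j" if "i < k + 50" "j < k + 50" for i j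
    using that cL inj_on_eq_iff[OF w_inj, of i j] by auto
  define r where "r = max (length u) (length v)"
  define R where "R = {x \<in> level r. \<not> prefix u x \<and> \<not> prefix v x}"
  define U where "U = (@) u ` L"
  define V where "V = (@) v ` L"
  define X where "X = U \<union> V \<union> R"
  have Rpar: "x \<parallel> u" "x \<parallel> v" if "x \<in> R" for x
  proof -
    have *: "length x = r" "\<not> prefix u x" "\<not> prefix v x" using that by (auto simp: R_def levelD)
    have "\<not> prefix x q" if "length q \<le> r" "\<not> prefix q x" for q
    proof
      assume "prefix x q"
      then obtain s where "q = x @ s" by (auto elim: prefixE)
      then show False using that *(1) by simp
    qed
    then show "x \<parallel> u" "x \<parallel> v" using *(2,3) by (auto simp: r_def)
  qed
  have shiftL: "antichain ((@) p ` L)" if "p \<in> words" for p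
    using L(2) that unfolding antichain_def pairwise_def by (auto simp: parallel_def)
  have cross: "a \<parallel> b \<and> b \<parallel> a" if "a \<in> U \<and> b \<in> V \<or> a \<in> R \<and> b \<in> U \<union> V" for a b
    using that uv vu Rpar parallel_commute parallel_append parallel_append2
    unfolding U_def V_def by (smt (verit) Un_iff image_iff)
  have R_ac: "antichain R" unfolding R_def by (rule antichain_subset[OF level_antichain]) auto
  have X: "antichain X"
    unfolding antichain_def
  proof (intro conjI)
    show "finite X" "X \<subseteq> words" using shiftL[OF u] shiftL[OF v] R_ac
      by (auto simp: X_def U_def V_def antichain_def)
    show "pairwise (\<parallel>) X"
      using shiftL[OF u, folded U_def] shiftL[OF v, folded V_def] R_ac cross
      unfolding X_def antichain_def pairwise_def by blast
  qed
  have disjoint: "U \<inter> V = {}" "U \<inter> R = {}" "V \<inter> R = {}"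
    using cross by (auto simp: parallel_def)
  \<comment> \<open>The first \<open>r\<close> letters form a word of \<open>R\<close> or extend
    \<open>u\<close> or \<open>v\<close>; in the latter case at least \<open>m\<close> letters
    follow \<open>u\<close> or \<open>v\<close>, enough for a word of \<open>L\<close>.\<close>
  have cover: "\<exists>p\<in>X. prefix p x" if x: "x \<in> words" "r + m \<le> length x" for x
  proof -
    have pre: "\<exists>p\<in>X. prefix p x" if q: "q = u \<or> q = v" "prefix q x" for q
    proof -
      obtain s where s: "x = q @ s" using q by (auto elim: prefixE)
      have "m \<le> length s" using x(2) s q(1) by (auto simp: r_def)
      moreover have "s \<in> words" using x(1) s by simp
      then have "take m s \<in> words" using words_simps(3)[of "take m s" "drop m s"] by simp
      ultimately have "take m s \<in> L" by (simp add: L_def level_def)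
      then have "q @ take m s \<in> X" using q(1) by (auto simp: X_def U_def V_def)
      moreover have "prefix (q @ take m s) x" by (simp add: s take_is_prefix)
      ultimately show ?thesis by blast
    qed
    have tr: "take r x \<in> level r"
      using x words_simps(3)[of "take r x" "drop r x"] by (simp add: level_def)
    show ?thesis
    proof (cases "take r x \<in> R")
      case True
      then have "take r x \<in> X" by (simp add: X_def)
      then show ?thesis using take_is_prefix by blast
    next
      case False
      then have "prefix u x \<or> prefix v x"
        using tr by (auto simp: R_def) (meson prefix_order.trans take_is_prefix)+
      then show ?thesis using pre by blast
    qed
  qed
  define K where "K = r + m"
  define e0 where "e0 = card (V - {v @ w 0, v @ w 1} \<union> R)"
  obtain e where e: "2 \<le> e" "e < 32" "(e0 + e) mod 30 = 1" using ex_residue_one by blast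
  \<comment> \<open>The \<open>k - n\<close> indices from 6 on and the \<open>n\<close> children
    together give a cycle of length exactly \<open>k\<close>.\<close>
  define g0 where "g0 = 6 + (k - n)"
  have g0: "6 < g0" "g0 + e < k + 50" using k e two_le by (auto simp: g0_def)
  \<comment> \<open>adding \<open>e\<close> words below \<open>u\<close> makes the length of the long cycle coprime to \<open>2\<close>, \<open>3\<close> and \<open>5\<close>\<close>
  define Ue where "Ue = (\<lambda>i. u @ w i) ` {g0..<g0 + e}"
  define X1 where "X1 = (V - {v @ w 0, v @ w 1} \<union> R) \<union> Ue"
  have UeU: "Ue \<subseteq> U" using w g0 by (auto simp: Ue_def U_def)
  have X1X: "X1 \<subseteq> X" using UeU by (auto simp: X1_def X_def)
  have fin: "finite X1" "finite X" using X X1X by (auto simp: antichain_def intro: finite_subset)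
  have "card X1 = e0 + card Ue"
    unfolding X1_def e0_def using fin(1) UeU disjoint by (intro card_Un_disjoint) (auto simp: X1_def)
  moreover have "card Ue = e"
    unfolding Ue_def using g0 w_eq by (subst card_image) (auto simp: inj_on_def)
  ultimately have cX1: "card X1 mod 30 = 1" using e by simp
  have z1: "v @ w 2 \<in> X1" using w[of 2] w_eq[of 2 0] w_eq[of 2 1] by (auto simp: X1_def V_def)
  obtain zs where zs: "set zs = X1 - {v @ w 2}" "distinct zs"
    using finite_distinct_list[of "X1 - {v @ w 2}"] fin(1) by auto
  define xs1 where "xs1 = (v @ w 2) # zs"
  have set1: "set xs1 = X1" "distinct xs1" using zs z1 by (auto simp: xs1_def)
  have len1: "length xs1 mod 30 = 1" using cX1 distinct_card[OF set1(2)] set1(1) by simp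
  have code1: "code xs1" by (rule antichain_code[OF X set1(2)]) (use set1 X1X in auto)
  define xs2 where "xs2 = [u @ w 0, u @ w 1, u @ w 2]"
  \<comment> \<open>a cycle of length \<open>5 ^ n\<close> that passes through all children of \<open>u @ w 3\<close>\<close>
  define ys3 where "ys3 = w 6 # map w [7..<g0] @ map (\<lambda>i. w 3 @ [i]) [0..<n]"
  define xs3 where "xs3 = map ((@) u) ys3"
  \<comment> \<open>padding makes the transposed words at least \<open>K\<close> long\<close>
  define pad where "pad = replicate K (0 :: nat)"
  have pad: "pad \<in> words" using two_le unfolding pad_def by (induction K) auto
  define xs4 where "xs4 = (if extra then [u @ w 4 @ pad, u @ w 5 @ pad] else [])"
  have Lpar: "w i @ s \<parallel> w j @ t" if "i < k + 50" "j < k + 50" "i \<noteq> j" for i j s t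
    using that w w_eq antichainD(2)[OF L(2)] by (intro parallel_append) auto
  have Lpar': "w i \<parallel> w j" "w i @ s \<parallel> w j" "w i \<parallel> w j @ t" if "i < k + 50" "j < k + 50" "i \<noteq> j" for i j s t
    using Lpar[OF that, of "[]" "[]"] Lpar[OF that, of s "[]"] Lpar[OF that, of "[]" t] by auto
  have ppar: "p @ s \<parallel> p @ t \<longleftrightarrow> s \<parallel> t" for p s t :: "nat list" by (auto simp: parallel_def)
  have sing: "[i] \<parallel> [j] \<longleftrightarrow> i \<noteq> j" for i j :: nat by (auto simp: parallel_def)
  have code2: "code [p @ w 0, p @ w 1, p @ w 2]" if "p \<in> words" for p
    using that w Lpar' by (simp add: ppar)
  have set3: "set ys3 = w ` {6..<g0} \<union> (\<lambda>i. w 3 @ [i]) ` {..<n}"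
    using g0 by (auto simp: ys3_def image_iff Bex_def) (metis Suc_leI eval_nat_numeral(3) le_neq_implies_less)
  have "w i \<noteq> w 3 @ [j]" if "i < k + 50" "i \<noteq> 3" for i j
    using Lpar'(3)[of i 3 "[j]"] that by (auto simp: parallel_def)
  then have dist3: "distinct ys3"
    using g0 w_eq by (auto simp: ys3_def distinct_map inj_on_def)
  have "w i \<parallel> w j" if "i < k + 50" "j < k + 50" "w i \<noteq> w j" for i j
    using Lpar'(1)[of i j] that by auto
  then have "pairwise (\<parallel>) (set ys3)"
    unfolding set3 using g0 Lpar'(2,3) by (auto simp: pairwise_def ppar sing)
  then have code3': "code (map ((@) p) ys3)" if "p \<in> words" for p
    unfolding code_def using that g0 w dist3
    by (auto simp: set3 pairwise_def ppar distinct_map intro!: sorted_wrt_parallelI inj_onI)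
  have len3: "length ys3 = k" using k by (simp add: ys3_def g0_def)
  have code4: "code xs4" using u w pad Lpar by (auto simp: xs4_def ppar code_def)
  define h1 where "h1 = cyc xs1"
  define h2 where "h2 = cyc xs2"
  define h3 where "h3 = cyc xs3"
  define h4 where "h4 = cyc xs4"
  have code_2: "code xs2" using code2[OF u] by (simp add: xs2_def)
  have code_3: "code xs3" using code3'[OF u] by (simp add: xs3_def)
  have hG: "h1 \<in> carrier G" "h2 \<in> carrier G" "h3 \<in> carrier G" "h4 \<in> carrier G"
    using code1 code_2 code_3 code4 by (simp_all add: h1_def h2_def h3_def h4_def)
  define P where "P I = (\<lambda>i. u @ w i) ` I" for I
  have PX: "P I \<subseteq> X" if "I \<subseteq> {..<k + 50}" for I using that w by (auto simp: P_def X_def U_def)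
  have P_disj: "P I \<inter> P J = {}" if "I \<subseteq> {..<k + 50}" "J \<subseteq> {..<k + 50}" "I \<inter> J = {}" for I J
  proof -
    have "w i \<noteq> w j" if "i \<in> I" "j \<in> J" for i j
    proof -
      have "i \<noteq> j" "i < k + 50" "j < k + 50" using that \<open>I \<subseteq> _\<close> \<open>J \<subseteq> _\<close> \<open>I \<inter> J = {}\<close> by auto
      then show ?thesis using w_eq by simp
    qed
    then show ?thesis by (auto simp: P_def)
  qed
  have ext1: "extends X1 xs1" using set1 by (auto simp: extends_def)
  have ext2: "extends (P {0, 1, 2}) xs2" by (auto simp: extends_def xs2_def P_def)
  have ext3: "extends (P (insert 3 {6..<g0})) xs3"
    unfolding extends_def xs3_def set_map set3 by (auto simp: P_def)
  have ext4: "extends (P {4, 5}) xs4" by (auto simp: extends_def xs4_def P_def)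
  have bound: "{0, 1, 2} \<subseteq> {..<k + 50}" "insert 3 {6..<g0} \<subseteq> {..<k + 50}" "{4, 5} \<subseteq> {..<k + 50}"
    "{g0..<g0 + e} \<subseteq> {..<k + 50}" using g0 by auto
  have UeP: "Ue = P {g0..<g0 + e}" by (simp add: P_def Ue_def)
  have X1P: "X1 \<inter> P I = {}" if "I \<subseteq> {..<k + 50}" "I \<inter> {g0..<g0 + e} = {}" for I
  proof -
    have "P I \<subseteq> U" using that w by (auto simp: P_def U_def)
    then show ?thesis using disjoint P_disj[OF that(1) bound(4) that(2)] UeP by (auto simp: X1_def)
  qed
  have comm: "h1 \<otimes> h2 = h2 \<otimes> h1" "h1 \<otimes> h3 = h3 \<otimes> h1" "h1 \<otimes> h4 = h4 \<otimes> h1"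
    "h2 \<otimes> h3 = h3 \<otimes> h2" "h2 \<otimes> h4 = h4 \<otimes> h2" "h3 \<otimes> h4 = h4 \<otimes> h3"
    unfolding h1_def h2_def h3_def h4_def
    by (intro extends_commute[OF X _ _ ext1 ext2] extends_commute[OF X _ _ ext1 ext3]
        extends_commute[OF X _ _ ext1 ext4] extends_commute[OF X _ _ ext2 ext3]
        extends_commute[OF X _ _ ext2 ext4] extends_commute[OF X _ _ ext3 ext4]
        Un_least X1X PX bound X1P P_disj code1 code_2 code_3 code4; use g0 in auto)+
  have h4_one: "h4 = \<one>" if "\<not> extra"
    using that by (intro carrier_ext) (use hG in \<open>auto simp: h4_def xs4_def cyc_outside\<close>)
  define p1 where "p1 = length xs1"
  have ord: "h1 [^] p1 = \<one>" "h2 [^] (3 :: nat) = \<one>" "h3 [^] k = \<one>" "h4 [^] (2 :: nat) = \<one>"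
  proof -
    show "h1 [^] p1 = \<one>" unfolding h1_def p1_def by (rule cyc_pow_length[OF code1])
    show "h2 [^] (3 :: nat) = \<one>" unfolding h2_def using cyc_pow_length[OF code_2] by (simp add: xs2_def numeral_3_eq_3)
    show "h3 [^] k = \<one>" unfolding h3_def using cyc_pow_length[OF code_3] by (simp add: xs3_def len3)
    show "h4 [^] (2 :: nat) = \<one>"
    proof (cases extra)
      case True
      then show ?thesis using cyc_pow_length[OF code4] by (simp add: h4_def xs4_def numeral_2_eq_2)
    next
      case False
      then have "h4 = \<one>" by (rule h4_one)
      then show ?thesis by simp
    qed
  qed
  have cop: "coprime p1 (3 * (k * 2))" "coprime 3 (k * 2)" "coprime k 2"
  proof -
    have "gcd p1 30 = gcd 30 1" using len1 by (metis gcd.commute gcd_red_nat p1_def)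
    then have "coprime p1 30" by (simp add: coprime_iff_gcd_eq_1)
    then have "coprime p1 (3 * 10)" "coprime p1 (5 * 6)" "coprime p1 (2 * 15)" by simp_all
    then have "coprime p1 3" "coprime p1 5" "coprime p1 2" unfolding coprime_mult_right_iff by blast+
    then show "coprime p1 (3 * (k * 2))" unfolding k_def coprime_mult_right_iff by simp
    have "coprime 3 (5 :: nat)" "coprime 3 (2 :: nat)" "coprime 5 (2 :: nat)" by (simp_all add: coprime_iff_gcd_eq_1 gcd_non_0_nat)
    then show "coprime 3 (k * 2)" "coprime k 2" by (simp_all add: k_def)
  qed
  have k0: "k \<noteq> 0" using k by simp
  \<comment> \<open>The product is nested so that \<open>commuting_coprime_factors\<close> splits
    off one factor at a time.\<close>
  define h34 where "h34 = h3 \<otimes> h4"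
  define h234 where "h234 = h2 \<otimes> h34"
  define h where "h = h1 \<otimes> h234"
  have hG': "h34 \<in> carrier G" "h234 \<in> carrier G" "h \<in> carrier G" using hG by (auto simp: h_def h234_def h34_def)
  have comm': "h2 \<otimes> h34 = h34 \<otimes> h2" "h1 \<otimes> h34 = h34 \<otimes> h1" "h1 \<otimes> h234 = h234 \<otimes> h1"
  proof -
    have *: "a \<otimes> (b \<otimes> c) = b \<otimes> c \<otimes> a"
      if "a \<in> carrier G" "b \<in> carrier G" "c \<in> carrier G" "a \<otimes> b = b \<otimes> a" "a \<otimes> c = c \<otimes> a" for a b c
      using that by (metis m_assoc)
    show "h2 \<otimes> h34 = h34 \<otimes> h2" and 1: "h1 \<otimes> h34 = h34 \<otimes> h1"
      unfolding h34_def using * hG comm by blast+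
    show "h1 \<otimes> h234 = h234 \<otimes> h1" unfolding h234_def using * hG hG' comm 1 by blast
  qed
  have pow1: "z [^] j = \<one>" if "z \<in> carrier G" "z [^] i = \<one>" "i dvd j" for z and i j :: nat
    using that by (auto elim!: dvdE simp flip: nat_pow_pow)
  have ord34: "h34 [^] (k * 2) = \<one>"
  proof -
    have "h3 [^] (k * 2) = \<one>" "h4 [^] (k * 2) = \<one>"
      by (rule pow1[OF hG(3) ord(3)], simp) (rule pow1[OF hG(4) ord(4)], simp)
    then show ?thesis using hG comm by (simp add: h34_def pow_mult_distrib)
  qed
  have ord234: "h234 [^] (3 * (k * 2)) = \<one>"
  proof -
    have "h2 [^] (3 * (k * 2)) = \<one>" "h34 [^] (3 * (k * 2)) = \<one>"
      by (rule pow1[OF hG(2) ord(2)], simp) (rule pow1[OF hG'(1) ord34], simp)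
    then show ?thesis using hG hG' comm' by (simp add: h234_def pow_mult_distrib)
  qed
  have parts: "h1 \<in> H" "h2 \<in> H" "h3 \<in> H" "h4 \<in> H" if H: "subgroup H G" and h: "h \<in> H" for H
  proof -
    note 1 = commuting_coprime_factors[OF H hG(1) hG'(2) comm'(3) ord(1) ord234 cop(1) _ h[unfolded h_def]]
    show "h1 \<in> H" using 1 k0 by simp
    have "h234 \<in> H" using 1 k0 by simp
    note 2 = commuting_coprime_factors[OF H hG(2) hG'(1) comm'(1) ord(2) ord34 cop(2) _ this[unfolded h234_def]]
    show "h2 \<in> H" using 2 k0 by simp
    have "h34 \<in> H" using 2 k0 by simp
    note 3 = commuting_coprime_factors[OF H hG(3,4) comm(6) ord(3,4) cop(3) _ this[unfolded h34_def]]
    show "h3 \<in> H" "h4 \<in> H" using 3 by simp_all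
  qed
  define x where "x = v @ w 0"
  define y where "y = v @ w 1"
  have xyw: "x \<in> words" "y \<in> words" "x \<noteq> y" "x \<parallel> y" "x \<in> X" "y \<in> X"
    using v w Lpar'(1)[of 0 1] w_eq[of 0 1] by (auto simp: x_def y_def ppar X_def V_def)
  have xyX1: "x \<notin> X1" "y \<notin> X1"
  proof -
    have "x \<in> V" "y \<in> V" using w by (auto simp: x_def y_def V_def)
    then show "x \<notin> X1" "y \<notin> X1" using disjoint UeU by (auto simp: X1_def x_def y_def)
  qed
  have deep: "deep K H" if H: "subgroup H G" and gH: "g \<in> H" and hH: "h \<in> H" for H
  proof -
    have gmap: "maps_cone g (u @ s) (v @ s)" if "s \<in> words" for s
      using maps_cone_append[OF guv that] .
    have "cyc xs2 \<in> H" using parts(2)[OF H hH] by (simp add: h2_def)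
    then have start1: "cyc [x, y, v @ w 2] \<in> H"
      unfolding x_def y_def xs2_def
      by (rule cyc3_conj_mem[OF H gH _ code2[OF u] gmap gmap gmap]) (use w in auto)
    have parX1: "x \<parallel> z \<and> y \<parallel> z" if "z \<in> X1" for z
      using that X1X xyX1 xyw antichainD(2)[OF X] by blast
    have star1: "cyc [x, y, z] \<in> H" if "z \<in> X1" for z
    proof (rule cyc_orbit_mem[OF H code1[unfolded xs1_def]])
      show "cyc ((v @ w 2) # zs) \<in> H" using parts(1)[OF H hH] by (simp add: h1_def xs1_def)
    qed (use that start1 xyw parX1 set1(1) in \<open>auto simp: xs1_def\<close>)
    define Y where "Y = insert x (insert y X1)"
    have YX: "Y \<subseteq> X" using X1X xyw by (auto simp: Y_def)
    have Y: "full H Y"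
      by (rule full_star[OF H antichain_subset[OF X YX], of x y]) (use xyw star1 in \<open>auto simp: Y_def\<close>)
    have VY: "V \<subseteq> Y" by (auto simp: Y_def X1_def x_def y_def)
    have V: "full H V" using full_subset[OF Y VY] .
    have Uf: "full H U"
    proof (rule full_transport[OF H _ V])
      show "inv g \<in> H" using H gH by (rule subgroup.m_inv_closed)
      show "V \<subseteq> words" using v L(3) by (auto simp: V_def)
      show "\<exists>s\<in>V. maps_cone (inv g) s t" if "t \<in> U" for t
        using that maps_cone_inv[OF g(1) _ gmap] L(3) u by (fastforce simp: U_def V_def)
    qed
    have XYU: "X = Y \<union> U" using YX VY by (auto simp: X_def Y_def X1_def)
    have "full H (Y \<union> U)"
    proof (rule full_Un[OF H _ Y Uf])
      show "antichain (Y \<union> U)" using X XYU by simp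
      \<comment> \<open>The overlap needed for gluing: the first two words of \<open>Ue\<close>,
        which exist because \<open>2 \<le> e\<close>.\<close>
      show "u @ w g0 \<in> Y \<inter> U" "u @ w (Suc g0) \<in> Y \<inter> U"
        using e UeU by (auto simp: Y_def X1_def Ue_def)
      show "u @ w g0 \<noteq> u @ w (Suc g0)" using g0 e w_eq[of g0 "Suc g0"] by simp
    qed
    then have XH: "full H X" by (simp add: XYU)
    define b where "b = v @ w 3"
    have b: "b \<in> X" "b \<noteq> x" "b \<noteq> y"
      using w[of 3] w_eq[of 3 0] w_eq[of 3 1] by (auto simp: b_def x_def y_def X_def V_def)
    have xs3': "cyc (map ((@) v) ys3) \<in> H"
    proof (rule cyc_conj_mem[OF H gH _ code_3])
      show "cyc xs3 \<in> H" using parts(3)[OF H hH] by (simp add: h3_def)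
      have "z \<in> words" if "z \<in> set ys3" for z using that w g0 by (auto simp: set3)
      then show "list_all2 (maps_cone g) xs3 (map ((@) v) ys3)"
        by (auto simp: xs3_def list_all2_conv_all_nth gmap)
    qed
    have par3: "x \<parallel> z \<and> y \<parallel> z" if "z \<in> set (map ((@) v) ys3)" for z
      using that g0 Lpar' by (auto simp: set3 x_def y_def ppar)
    have star3: "cyc [x, y, v @ w 3 @ [i]] \<in> H" if "i < n" for i
    proof -
      have eq: "map ((@) v) ys3 = (v @ w 6) # map ((@) v) (tl ys3)" by (simp add: ys3_def)
      have "v @ w 6 \<in> X" using w[of 6] by (auto simp: X_def V_def)
      then have "cyc [x, y, v @ w 6] \<in> H"
        using full_cyc3[OF X XH xyw(5,6), of "v @ w 6"] xyw w_eq[of 6 0] w_eq[of 6 1] by (simp add: x_def y_def)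
      then show ?thesis
        using cyc_orbit_mem[OF H code3'[OF v, unfolded eq] xs3'[unfolded eq] xyw(1,2,4) par3[unfolded eq], of "v @ w 3 @ [i]"]
          that unfolding eq[symmetric] by (simp add: set3)
    qed
    have XbH: "full H (expand X b)"
    proof (rule full_star[OF H antichain_expand[OF X b(1)], of x y])
      show "x \<in> expand X b" "y \<in> expand X b" using xyw b by (auto simp: expand_def)
      fix z assume "z \<in> expand X b" "z \<noteq> x" "z \<noteq> y"
      then show "cyc [x, y, z] \<in> H"
        using full_cyc3[OF X XH xyw(5,6), of z] xyw(3) star3 by (auto simp: expand_def b_def)
    qed (use xyw in simp)
    have "card V = card L" unfolding V_def by (intro card_image) (auto simp: inj_on_def)
    moreover have "card V \<le> card X" using fin(2) by (intro card_mono) (auto simp: X_def)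
    ultimately have "5 \<le> card X" using cL by simp
    then have exp: "expansive H X" using expansiveI[OF H X _ XH b(1) XbH] by blast
    show "deep K H"
      unfolding deep_def
    proof (intro allI impI)
      fix a b c assume code: "code [a, b, c]" and len: "K \<le> length a" "K \<le> length b" "K \<le> length c"
      obtain pa pb pc where p: "pa \<in> X" "prefix pa a" "pb \<in> X" "prefix pb b" "pc \<in> X" "prefix pc c"
        using cover[of a] cover[of b] cover[of c] code len by (auto simp: K_def)
      then obtain sa sb sc where "a = pa @ sa" "b = pb @ sb" "c = pc @ sc" unfolding prefix_def by blast
      then show "cyc [a, b, c] \<in> H" using expansive_cyc3[OF H exp p(1,3,5)] code by blast
    qed
  qed
  have "\<exists>p q. code [p, q] \<and> K \<le> length p \<and> length p = length q \<and> cyc [p, q] \<in> H"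
    if "extra" "subgroup H G" "h \<in> H" for H
  proof (intro exI conjI)
    show "code [u @ w 4 @ pad, u @ w 5 @ pad]" "cyc [u @ w 4 @ pad, u @ w 5 @ pad] \<in> H"
      using code4 parts(4)[OF that(2,3)] that(1) by (simp_all add: xs4_def h4_def)
    show "K \<le> length (u @ w 4 @ pad)" by (simp add: pad_def)
    show "length (u @ w 4 @ pad) = length (u @ w 5 @ pad)" using w(1)[of 4] w(1)[of 5] by (simp add: L_def levelD)
  qed
  moreover have "h \<in> derived G (carrier G)" if "\<not> extra"
  proof -
    have odd: "odd p1" "odd (3 :: nat)" "odd k"
      using len1 unfolding p1_def k_def by (presburger, simp_all)
    then have "h1 \<in> derived G (carrier G)" "h2 \<in> derived G (carrier G)" "h3 \<in> derived G (carrier G)"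
      using odd_order_derived[OF hG(1) ord(1)] odd_order_derived[OF hG(2) ord(2)]
        odd_order_derived[OF hG(3) ord(3)] by blast+
    moreover have "h4 = \<one>" using that by (rule h4_one)
    moreover have D: "subgroup (derived G (carrier G)) G" by (rule derived_is_subgroup) simp
    ultimately show ?thesis
      unfolding h_def h234_def h34_def by (auto intro!: subgroup.m_closed[OF D] subgroup.one_closed[OF D])
  qed
  ultimately show ?thesis using deep hG'(3) by blast
qed

section \<open>Generating both groups from an arbitrary nontrivial element\<close>

lemma three_halves_generated_G: "three_halves_generated G"
  and three_halves_generated_derived: "three_halves_generated (derived_subgroup G)"
proof -
  define D where "D = derived G (carrier G)"
  have D: "subgroup D G" unfolding D_def by (rule derived_is_subgroup) simp
  have DG: "D \<subseteq> carrier G" using D by (rule subgroup.subset)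
  have gen: "\<exists>h\<in>carrier G. generate G {g, h} = carrier G" if g: "g \<in> carrier G" "g \<noteq> \<one>" for g
  proof -
    obtain h K where h: "h \<in> carrier G"
      and K: "\<And>H. subgroup H G \<Longrightarrow> g \<in> H \<Longrightarrow> h \<in> H \<Longrightarrow> deep K H \<and>
        (\<exists>p q. code [p, q] \<and> K \<le> length p \<and> length p = length q \<and> cyc [p, q] \<in> H)"
      using generation[OF g, of True] by auto
    define H where "H = generate G {g, h}"
    have H: "subgroup H G" unfolding H_def by (rule generate_is_subgroup) (use g h in auto)
    have "g \<in> H" "h \<in> H" by (auto simp: H_def intro: generate.incl)
    then obtain p q where deep: "deep K H"
      and pq: "code [p, q]" "K \<le> length p" "length p = length q" "cyc [p, q] \<in> H" using K[OF H] by blast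
    \<comment> \<open>The transposition that represents the possible second coset lies in
      \<open>H\<close>, so \<open>H\<close> is the only coset.\<close>
    have "f \<in> H" if f: "f \<in> carrier G" for f
      using index_two_mult[OF H cyc_carrier[OF pq(1)] deep_index_two[OF H deep pq(1-3)] f cyc_carrier[OF pq(1)]]
        deep_index_two[OF H deep pq(1-3) f] pq(4) by blast
    then have "H = carrier G" using subgroup.subset[OF H] by blast
    then show ?thesis using h by (auto simp: H_def)
  qed
  have genD: "\<exists>h\<in>D. generate G {g, h} = D" if g: "g \<in> D" "g \<noteq> \<one>" for g
  proof -
    obtain h K where h: "h \<in> D"
      and K: "\<And>H. subgroup H G \<Longrightarrow> g \<in> H \<Longrightarrow> h \<in> H \<Longrightarrow> deep K H"
      using generation[of g False] g DG unfolding D_def by blast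
    define H where "H = generate G {g, h}"
    have H: "subgroup H G" unfolding H_def by (rule generate_is_subgroup) (use g h DG in auto)
    have deep: "deep K H" by (rule K[OF H]) (auto simp: H_def intro: generate.incl)
    have HD: "H \<subseteq> D" unfolding H_def by (rule generate_subgroup_incl[OF _ D]) (use g h in auto)
    define pad where "pad = replicate K (0 :: nat)"
    have "pad \<in> words" using two_le unfolding pad_def by (induction K) auto
    then have pq: "code [0 # pad, 1 # pad]" using two_le by (auto simp: parallel_def)
    have "D \<subseteq> H" unfolding D_def
      by (rule index_two_derived[OF H cyc_carrier[OF pq] deep_index_two[OF H deep pq]]) (auto simp: pad_def)
    then show ?thesis using HD h by (auto simp: H_def)
  qed
  \<comment> \<open>A nontrivial element of the derived subgroup; its partner provides the
    generating pair demanded by the first clause. Words of length 2 are used because for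
    \<open>n = 2\<close> there are only two words of length 1.\<close>
  define s where "s = cyc [[0, 0], [0, 1], [1, 0]]"
  have code: "code [[0, 0], [0, 1], [1, 0]]" using two_le by (auto simp: parallel_def)
  have sD: "s \<in> D" unfolding s_def D_def by (rule cyc3_derived[OF code])
  have "s \<noteq> \<one>"
  proof
    assume "s = \<one>"
    moreover have "s ([0, 0] @- sconst 0) = [0, 1] @- sconst 0"
      unfolding s_def by (rule maps_coneD[OF cyc3_maps(1)[OF code] zeros_in_C])
    moreover have "[0, 0] @- sconst 0 \<in> C" using two_le by (subst shift_in_C) simp
    ultimately show False by simp
  qed
  then show "three_halves_generated G"
    unfolding three_halves_generated_def using gen sD DG is_group by blast
  have carr: "carrier (derived_subgroup G) = D" by (simp add: derived_subgroup_def D_def)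
  have one: "\<one>\<^bsub>derived_subgroup G\<^esub> = \<one>" by (simp add: derived_subgroup_def)
  have gn: "generate (derived_subgroup G) S = generate G S" if "S \<subseteq> D" for S
    unfolding derived_subgroup_def using generate_consistent[OF that D] by (simp add: D_def)
  have grp: "group (derived_subgroup G)"
    unfolding derived_subgroup_def using subgroup_imp_group[OF D] by (simp add: D_def)
  have "\<exists>h\<in>D. generate (derived_subgroup G) {g, h} = D" if "g \<in> D" "g \<noteq> \<one>" for g
    using genD[OF that] gn that(1) by (metis empty_subsetI insert_subset)
  then show "three_halves_generated (derived_subgroup G)"
    unfolding three_halves_generated_def carr one using grp sD \<open>s \<noteq> \<one>\<close> by blast
qed

end

theorem theorem1:
  fixes n :: nat
  assumes "n \<ge> 2"
  shows "three_halves_generated (higman_thompson n) \<and>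
    three_halves_generated (derived_subgroup (higman_thompson n))"
proof -
  interpret higman_thompson_group n "higman_thompson n"
    by unfold_locales (use assms in auto)
  show ?thesis using three_halves_generated_G three_halves_generated_derived by simp
qed

end
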